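(* Let $\mathcal{D}\subset\mathbb{R}^N$ be open, bounded, connected, and assume $y_0\in\partial\mathcal{D}$ satisfies the exterior cone condition, i.e. there exists a finite cone $C\subset\mathbb{R}^N\setminus\mathcal{D}$ with tip at $y_0$. Then $y_0$ is walk-regular.
   Context: A finite cone with tip at $y_0$ is a set of the form $\{y_0+v: 0<|v|<h,\ \angle(v,e)<\alpha\}$ (together with its tip) for some unit vector $e$, height $h>0$ and aperture $\alpha\in(0,\pi/2)$. Probability space: $\Omega_1=B_1(0)\subset\mathbb{R}^N$ with Borel $\sigma$-algebra and normalised Lebesgue measure; $(\Omega,\mathcal{F},\mathbb{P})$ is the countable product $\Omega=(\Omega_1)^{\mathbb{N}}$, $\omega=\{w_i\}_{i\ge1}$. The $\epsilon$-ball walk started at $x\in\mathcal{D}$: $X_0^{\epsilon,x}\equiv x$, $X_n^{\epsilon,x}=X_{n-1}^{\epsilon,x}+\big(\epsilon\wedge\operatorname{dist}(X_{n-1}^{\epsilon,x},\partial\mathcal{D})\big)w_n$ for $n\ge1$; it converges $\mathbb{P}$-a.s. to a random variable $X^{\epsilon,x}:\Omega\to\partial\mathcal{D}$. A point $y_0\in\partial\mathcal{D}$ is walk-regular if for every $\eta,\delta>0$ there exist $\hat\delta\in(0,\delta)$ and $\hat\epsilon\in(0,1)$ such that $\mathbb{P}(X^{\epsilon,x_0}\in B_\delta(y_0))\ge1-\eta$ for all $\epsilon\in(0,\hat\epsilon)$ and all $x_0\in B_{\hat\delta}(y_0)\cap\mathcal{D}$. *)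

theory Defs
  imports "HOL-Probability.Probability"
begin

text \<open>Finite cone with tip y0, axis e (unit vector), height h, aperture alpha:
  the tip together with all y0 + v, 0 < |v| < h, angle(v,e) < alpha.
  The angle between nonzero v and unit e is arccos((v . e)/|v|).\<close>
definition finite_cone :: "'a::euclidean_space \<Rightarrow> 'a \<Rightarrow> real \<Rightarrow> real \<Rightarrow> 'a set" where
  "finite_cone y0 e h \<alpha> =
     insert y0 {y0 + v | v. 0 < norm v \<and> norm v < h \<and> arccos ((v \<bullet> e) / norm v) < \<alpha>}"

definition exterior_cone_condition :: "'a::euclidean_space set \<Rightarrow> 'a \<Rightarrow> bool" where
  "exterior_cone_condition D y0 \<longleftrightarrow>
     (\<exists>e h \<alpha>. norm e = 1 \<and> h > 0 \<and> 0 < \<alpha> \<and> \<alpha> < pi / 2 \<and>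
              finite_cone y0 e h \<alpha> \<subseteq> - D)"

definition ball_space :: "'a::euclidean_space measure" where
  "ball_space = uniform_measure lborel (ball 0 1)"

text \<open>Countable product probability space; omega i is w_i (index 0 unused).\<close>
definition walk_space :: "(nat \<Rightarrow> 'a::euclidean_space) measure" where
  "walk_space = (\<Pi>\<^sub>M i\<in>(UNIV::nat set). ball_space)"

fun ball_walk :: "'a::euclidean_space set \<Rightarrow> real \<Rightarrow> 'a \<Rightarrow> (nat \<Rightarrow> 'a) \<Rightarrow> nat \<Rightarrow> 'a" where
  "ball_walk D \<epsilon> x \<omega> 0 = x"
| "ball_walk D \<epsilon> x \<omega> (Suc n) =
     ball_walk D \<epsilon> x \<omega> n
     + (min \<epsilon> (infdist (ball_walk D \<epsilon> x \<omega> n) (frontier D))) *\<^sub>R \<omega> (Suc n)"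

text \<open>P(X^{eps,x} in B_delta(y0)), where X^{eps,x} is the (a.s.) limit of the walk.\<close>
definition hit_prob :: "'a::euclidean_space set \<Rightarrow> real \<Rightarrow> 'a \<Rightarrow> 'a \<Rightarrow> real \<Rightarrow> real" where
  "hit_prob D \<epsilon> x y0 \<delta> =
     measure walk_space
       {\<omega> \<in> space walk_space. \<exists>y. (ball_walk D \<epsilon> x \<omega> \<longlonglongrightarrow> y) \<and> y \<in> ball y0 \<delta>}"

definition walk_regular :: "'a::euclidean_space set \<Rightarrow> 'a \<Rightarrow> bool" where
  "walk_regular D y0 \<longleftrightarrow>
     (\<forall>\<eta>>0. \<forall>\<delta>>0. \<exists>\<delta>'. 0 < \<delta>' \<and> \<delta>' < \<delta> \<and> (\<exists>\<epsilon>'. 0 < \<epsilon>' \<and> \<epsilon>' < 1 \<and>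
        (\<forall>\<epsilon>. 0 < \<epsilon> \<and> \<epsilon> < \<epsilon>' \<longrightarrow>
           (\<forall>x0 \<in> ball y0 \<delta>' \<inter> D. hit_prob D \<epsilon> x0 y0 \<delta> \<ge> 1 - \<eta>))))"

end

theory Submission
  imports Defs
begin

text \<open>An exterior cone at \<open>y0\<close> carries an explicit positive superharmonic function \<open>u\<close> on \<open>D\<close> near \<open>y0\<close> that is
  comparable to \<open>|x - y0| powr p\<close> for some \<open>p > 0\<close>. Every step of the walk averages over a ball inside \<open>D\<close>,
  so \<open>u\<close> evaluated along the walk is a supermartingale whatever \<open>\<epsilon>\<close> is, and the maximal inequality
  bounds the probability of ever leaving \<open>B_R(y0)\<close> by a constant times \<open>(|x0 - y0| / R) powr p\<close>.
  The walk is moreover a bounded martingale, hence converges almost surely, and a path that never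
  leaves \<open>B_R(y0)\<close> has its limit in the closure of that ball.\<close>

section \<open>The mean value inequality for superharmonic functions\<close>

text \<open>Steps are uniform on solid balls, so the mean value inequality is needed for ball
  averages only, and no surface measure enters. The obstacle is the full radius: a step ball is open
  and lies in \<open>D\<close>, but its closure may reach the frontier, even \<open>y0\<close>, off
  which alone the barrier is known to be smooth. The inequality is therefore shown for smaller radii
  and carried to the limit by Fatou, which is one reason to keep \<open>u\<close> nonnegative. The
  barrier is superharmonic only below the height \<open>h\<close> of the cone. This is the sole
  reason for bounding \<epsilon> in terms of \<open>h\<close>; the estimate itself is uniform in
  \<epsilon>. \<open>hit_prob\<close> counts only paths that have a limit, so almost sure
  convergence is part of the claim and is proved here. Filtrations, stopping times and conditional
  expectations are replaced by inequalities \<open>step_op V y \<le> V y\<close> between functions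
  of the current position, combined with a first-step decomposition and induction on time. Values in
  \<open>ennreal\<close> spare all integrability checks there.\<close>

text \<open>Dominated convergence for difference quotients, dominated by \<open>C\<close>.
  Differentiability is asked only at \<open>a\<close> and almost everywhere because the cut-off
  weight used below has a kink on the unit sphere; the Lipschitz bound survives the kink.\<close>

lemma DERIV_lebesgue_integral:
  fixes f :: "real \<Rightarrow> 'b \<Rightarrow> real"
  assumes "d > 0"
    and int: "\<And>t. \<bar>t - a\<bar> < d \<Longrightarrow> integrable M (f t)"
    and der: "AE w in M. ((\<lambda>t. f t w) has_real_derivative f' w) (at a)"
    and lip: "\<And>t w. \<bar>t - a\<bar> < d \<Longrightarrow> \<bar>f t w - f a w\<bar> \<le> C w * \<bar>t - a\<bar>"
    and C: "integrable M C"
    and meas: "f' \<in> borel_measurable M"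
  shows "((\<lambda>t. \<integral>w. f t w \<partial>M) has_real_derivative (\<integral>w. f' w \<partial>M)) (at a)"
  unfolding has_field_derivative_iff tendsto_at_iff_sequentially comp_def
proof (intro allI impI)
  fix X :: "nat \<Rightarrow> real"
  assume X: "\<forall>i. X i \<in> UNIV - {a}" and lim: "X \<longlonglongrightarrow> a"
  obtain N where N: "\<And>n. n \<ge> N \<Longrightarrow> \<bar>X n - a\<bar> < d"
    using LIMSEQ_D[OF lim \<open>d > 0\<close>] by auto
  define Y where "Y = (\<lambda>n. X (n + N))"
  have Y: "Y \<longlonglongrightarrow> a" and Yd: "\<bar>Y n - a\<bar> < d" and Ya: "Y n \<noteq> a" for n
    using LIMSEQ_ignore_initial_segment[OF lim, of N] N X by (auto simp: Y_def)
  have ia: "integrable M (f a)"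
    using int[of a] \<open>d > 0\<close> by simp
  have "(\<lambda>n. \<integral>w. (f (Y n) w - f a w) / (Y n - a) \<partial>M) \<longlonglongrightarrow> (\<integral>w. f' w \<partial>M)"
  proof (rule integral_dominated_convergence[OF meas _ C])
    show "(\<lambda>w. (f (Y n) w - f a w) / (Y n - a)) \<in> borel_measurable M" for n
      using int[OF Yd] ia by (intro borel_measurable_divide borel_measurable_diff) auto
    show "AE w in M. (\<lambda>n. (f (Y n) w - f a w) / (Y n - a)) \<longlonglongrightarrow> f' w"
      using der
    proof eventually_elim
      case (elim w)
      then show ?case
        unfolding has_field_derivative_iff tendsto_at_iff_sequentially comp_def
        using Y Ya by auto
    qed
    show "AE w in M. norm ((f (Y n) w - f a w) / (Y n - a)) \<le> C w" for n
      using lip[OF Yd] Ya by (auto simp: divide_le_eq intro!: AE_I2)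
  qed
  moreover have "(\<integral>w. (f (Y n) w - f a w) / (Y n - a) \<partial>M) =
      ((\<integral>w. f (Y n) w \<partial>M) - (\<integral>w. f a w \<partial>M)) / (Y n - a)" for n
    by (simp add: Bochner_Integration.integral_diff[OF int[OF Yd] ia])
  ultimately have "(\<lambda>n. ((\<integral>w. f (Y n) w \<partial>M) - (\<integral>w. f a w \<partial>M)) / (Y n - a))
      \<longlonglongrightarrow> (\<integral>w. f' w \<partial>M)"
    by (simp only:)
  then show "(\<lambda>n. ((\<integral>w. f (X n) w \<partial>M) - (\<integral>w. f a w \<partial>M)) / (X n - a))
      \<longlonglongrightarrow> (\<integral>w. f' w \<partial>M)"
    unfolding Y_def by (rule LIMSEQ_offset)
qed

lemma integral_lborel_translation:
  fixes F :: "'a::euclidean_space \<Rightarrow> real"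
  assumes "integrable lborel F"
  shows "integrable lborel (\<lambda>w. F (w + c))" "(\<integral>w. F (w + c) \<partial>lborel) = (\<integral>w. F w \<partial>lborel)"
proof -
  have F: "F \<in> borel_measurable borel" using assms by auto
  have "integrable (distr lborel borel ((+) c)) F"
    using assms by (simp add: lborel_distr_plus)
  then show "integrable lborel (\<lambda>w. F (w + c))"
    using F by (subst (asm) integrable_distr_eq) (auto simp: add.commute)
  have "(\<integral>w. F w \<partial>lborel) = (\<integral>w. F w \<partial>distr lborel borel ((+) c))"
    by (simp add: lborel_distr_plus)
  also have "\<dots> = (\<integral>w. F (c + w) \<partial>lborel)"
    using F by (subst integral_distr) auto
  finally show "(\<integral>w. F (w + c) \<partial>lborel) = (\<integral>w. F w \<partial>lborel)"
    by (simp add: add.commute)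
qed

text \<open>The weight \<open>1 - |w|\<^sup>2\<close> vanishes on the unit sphere and has gradient \<open>-2w\<close>. The integral of
  the product with \<open>k\<close> does not change under translation of the argument along \<open>b\<close>; differentiating
  this gives the integration by parts formula without any boundary term.\<close>

lemma integral_weighted_partial_derivative:
  fixes k k' :: "'a::euclidean_space \<Rightarrow> real" and b :: 'a
  assumes "\<rho> > 1" and b: "norm b = 1"
    and der: "\<And>x. x \<in> ball 0 \<rho> \<Longrightarrow> (k has_derivative K x) (at x)"
    and K: "\<And>x. x \<in> ball 0 \<rho> \<Longrightarrow> K x b = k' x"
    and cont: "continuous_on (ball 0 \<rho>) k'"
  shows "(\<integral>w. indicator (cball 0 1) w * ((1 - (norm w)\<^sup>2) * k' w - 2 * (w \<bullet> b) * k w) \<partial>lborel) = 0"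
proof -
  define \<eta> where "\<eta> = (\<rho> - 1) / 2"
  have \<eta>: "\<eta> > 0" "1 + \<eta> < \<rho>" using \<open>\<rho> > 1\<close> by (auto simp: \<eta>_def field_simps)
  define B :: "'a set" where "B = cball 0 (1 + \<eta>)"
  have B: "compact B" "convex B" "B \<subseteq> ball 0 \<rho>" "cball 0 1 \<subseteq> B"
    using \<eta> by (auto simp: B_def)
  have kc: "continuous_on (ball 0 \<rho>) k"
    using der by (meson continuous_at_imp_continuous_on has_derivative_continuous)
  obtain C1 where C1: "\<And>w. w \<in> B \<Longrightarrow> \<bar>k w\<bar> \<le> C1"
    using compact_imp_bounded[OF compact_continuous_image[OF continuous_on_subset[OF kc B(3)] B(1)]]
    by (auto simp: bounded_iff)
  obtain C2 where C2: "\<And>w. w \<in> B \<Longrightarrow> \<bar>k' w\<bar> \<le> C2"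
    using compact_imp_bounded[OF compact_continuous_image[OF continuous_on_subset[OF cont B(3)] B(1)]]
    by (auto simp: bounded_iff)
  have C1_0: "0 \<le> C1" using C1[of 0] \<eta> by (auto simp: B_def)
  \<comment> \<open>Truncation at 0 makes the weight Lipschitz on bounded sets across the sphere, so
    it can be translated without a moving domain of integration.\<close>
  define \<psi> :: "'a \<Rightarrow> real" where "\<psi> w = max 0 (1 - (norm w)\<^sup>2)" for w
  define F where "F w = \<psi> w * k w" for w
  have \<psi>_ind: "\<psi> w = indicator (cball 0 1) w * (1 - (norm w)\<^sup>2)" for w :: 'a
    by (auto simp: \<psi>_def indicator_def max_def power_le_one_iff abs_square_le_1)
  have \<psi>01: "0 \<le> \<psi> w" "\<psi> w \<le> 1" for w by (auto simp: \<psi>_def)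
  have \<psi>out: "\<psi> w = 0" if "norm w \<ge> 1" for w
    using one_le_power[OF that, of 2] by (simp add: \<psi>_def)
  have dirder: "((\<lambda>t. k (w + t *\<^sub>R b)) has_real_derivative k' (w + t *\<^sub>R b)) (at t within T)"
    if "w + t *\<^sub>R b \<in> ball 0 \<rho>" for w t T
  proof -
    have "((\<lambda>t. k (w + t *\<^sub>R b)) has_derivative (\<lambda>h. K (w + t *\<^sub>R b) (h *\<^sub>R b))) (at t within T)"
      by (rule has_derivative_compose[where f = "\<lambda>t. w + t *\<^sub>R b" and g = k, OF _ der[OF that]])
        (auto intro!: derivative_eq_intros)
    moreover have "K (w + t *\<^sub>R b) (h *\<^sub>R b) = k' (w + t *\<^sub>R b) * h" for h
      using linear_scale[OF has_derivative_linear[OF der[OF that]]] K[OF that] by simp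
    ultimately show ?thesis by (simp add: has_field_derivative_def)
  qed
  have intF: "integrable lborel F"
  proof -
    have "continuous_on (cball 0 1) (\<lambda>w. (1 - (norm w)\<^sup>2) * k w)"
      using continuous_on_subset[OF kc] B by (intro continuous_intros) auto
    from borel_integrable_compact[OF _ this] show ?thesis
      by (simp add: F_def[abs_def] \<psi>_ind mult.assoc)
  qed
  define f' where "f' w = indicator (cball 0 1) w * ((1 - (norm w)\<^sup>2) * k' w - 2 * (w \<bullet> b) * k w)" for w
  have "((\<lambda>t. \<integral>w. F (w + t *\<^sub>R b) \<partial>lborel) has_real_derivative (\<integral>w. f' w \<partial>lborel)) (at 0)"
  \<comment> \<open>The dominating constant is a product rule in Lipschitz form on \<open>B\<close>:
    \<open>\<psi> \<le> 1\<close> has Lipschitz constant \<open>2 * (1 + \<eta>)\<close>,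
    \<open>C1\<close> bounds \<open>k\<close>, and \<open>C2\<close> bounds its derivative along
    \<open>b\<close>.\<close>
  proof (rule DERIV_lebesgue_integral[where d = \<eta> and C = "\<lambda>w. indicator B w *\<^sub>R (2 * (1 + \<eta>) * C1 + C2)"])
    show "\<eta> > 0" by fact
    show "integrable lborel (\<lambda>w. F (w + t *\<^sub>R b))" for t
      by (rule integral_lborel_translation[OF intF])
    show "integrable lborel (\<lambda>w. indicator B w *\<^sub>R (2 * (1 + \<eta>) * C1 + C2))"
      by (rule borel_integrable_compact[OF B(1)]) auto
    have "continuous_on (cball 0 1) (\<lambda>w. (1 - (norm w)\<^sup>2) * k' w - 2 * (w \<bullet> b) * k w)"
      using continuous_on_subset[OF kc] continuous_on_subset[OF cont] B by (intro continuous_intros) auto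
    from borel_integrable_compact[OF _ this] show "f' \<in> borel_measurable lborel"
      by (auto simp: f'_def[abs_def])
    have "AE w in lborel. w \<notin> sphere (0::'a) 1"
      using negligible_sphere[of "0::'a" 1] by (intro AE_not_in) (simp add: negligible_iff_null_sets null_sets_completion_iff)
    then show "AE w in lborel. ((\<lambda>t. F (w + t *\<^sub>R b)) has_real_derivative f' w) (at 0)"
    proof eventually_elim
      case (elim w)
      consider "norm w < 1" | "norm w > 1" using elim by force
      then show ?case
      proof cases
        case 1
        have "((\<lambda>t. (1 - (norm (w + t *\<^sub>R b))\<^sup>2) * k (w + t *\<^sub>R b)) has_real_derivative f' w) (at 0)"
          unfolding power2_norm_eq_inner
          using 1 \<open>\<rho> > 1\<close>
          by (auto intro!: derivative_eq_intros dirder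
              simp: f'_def power2_norm_eq_inner inner_commute algebra_simps)
        then show ?thesis
        proof (rule has_field_derivative_transform_within_open[where S = "(\<lambda>t. w + t *\<^sub>R b) -` ball 0 1"])
          show "open ((\<lambda>t. w + t *\<^sub>R b) -` ball 0 1)"
            by (intro open_vimage continuous_intros) auto
        qed (use 1 in \<open>auto simp: F_def \<psi>_ind\<close>)
      next
        case 2
        have "((\<lambda>t. 0) has_real_derivative f' w) (at 0)"
          using 2 by (simp add: f'_def)
        then show ?thesis
        proof (rule has_field_derivative_transform_within_open[where S = "(\<lambda>t. w + t *\<^sub>R b) -` (- cball 0 1)"])
          show "open ((\<lambda>t. w + t *\<^sub>R b) -` (- cball 0 1))"
            by (intro open_vimage continuous_intros) auto
        qed (use 2 in \<open>auto simp: F_def \<psi>_ind\<close>)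
      qed
    qed
    show "\<bar>F (w + t *\<^sub>R b) - F (w + 0 *\<^sub>R b)\<bar> \<le> indicator B w *\<^sub>R (2 * (1 + \<eta>) * C1 + C2) * \<bar>t - 0\<bar>"
      if t: "\<bar>t - 0\<bar> < \<eta>" for t w
    proof -
      have tri: "\<bar>norm (w + t *\<^sub>R b) - norm w\<bar> \<le> \<bar>t\<bar>"
        using norm_triangle_ineq3[of "w + t *\<^sub>R b" w] b by simp
      show ?thesis
      \<comment> \<open>If neither point is in the open unit ball, both values vanish; otherwise one
        is, and the shift by less than \<eta> keeps both in \<open>B\<close>.\<close>
      proof (cases "norm w \<ge> 1 \<and> norm (w + t *\<^sub>R b) \<ge> 1")
        case True
        then have "F (w + t *\<^sub>R b) - F (w + 0 *\<^sub>R b) = 0" by (simp add: F_def \<psi>out)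
        moreover have "0 \<le> C2" using C2[of 0] \<eta> by (auto simp: B_def)
        ultimately show ?thesis using C1_0 \<eta> by (simp add: indicator_def)
      next
        case False
        then have wB: "w \<in> B" "w + t *\<^sub>R b \<in> B" using tri t \<eta> by (auto simp: B_def)
        let ?w = "w + t *\<^sub>R b"
        have kd: "\<bar>k ?w - k w\<bar> \<le> C2 * \<bar>t\<bar>"
        proof -
          let ?T = "{\<tau>. w + \<tau> *\<^sub>R b \<in> B}"
          have "convex ?T"
          proof -
            have "?T = (\<lambda>\<tau>. \<tau> *\<^sub>R b) -` ((\<lambda>y. w + y) -` B)" by auto
            moreover have "convex ((\<lambda>y. w + y) -` B)"
            proof -
              have "(\<lambda>y. w + y) -` B = cball (- w) (1 + \<eta>)"
                by (auto simp: B_def dist_norm add.commute norm_minus_commute)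
              then show ?thesis by simp
            qed
            ultimately show ?thesis
              by (metis (no_types) convex_linear_vimage linear_scaleR_left)
          qed
          then have "norm (k (w + t *\<^sub>R b) - k (w + 0 *\<^sub>R b)) \<le> C2 * norm (t - 0)"
            by (rule field_differentiable_bound[where f' = "\<lambda>\<tau>. k' (w + \<tau> *\<^sub>R b)"])
              (use wB B C2 in \<open>auto intro!: dirder\<close>)
          then show ?thesis by simp
        qed
        have "\<bar>\<psi> ?w - \<psi> w\<bar> \<le> \<bar>(norm ?w)\<^sup>2 - (norm w)\<^sup>2\<bar>"
          by (auto simp: \<psi>_def max_def)
        also have "\<dots> = \<bar>norm ?w - norm w\<bar> * (norm ?w + norm w)"
          by (simp add: power2_eq_square square_diff_square_factored abs_mult mult.commute)
        also have "\<dots> \<le> \<bar>t\<bar> * (2 * (1 + \<eta>))"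
          using tri wB by (intro mult_mono) (auto simp: B_def)
        finally have \<psi>d: "\<bar>\<psi> ?w - \<psi> w\<bar> \<le> \<bar>t\<bar> * (2 * (1 + \<eta>))" .
        have "F ?w - F w = (\<psi> ?w - \<psi> w) * k ?w + \<psi> w * (k ?w - k w)"
          by (simp add: F_def algebra_simps)
        then have "\<bar>F ?w - F w\<bar> \<le> \<bar>\<psi> ?w - \<psi> w\<bar> * \<bar>k ?w\<bar> + \<psi> w * \<bar>k ?w - k w\<bar>"
          using \<psi>01(1)[of w] by (metis abs_mult abs_of_nonneg abs_triangle_ineq)
        also have "\<dots> \<le> (\<bar>t\<bar> * (2 * (1 + \<eta>))) * C1 + 1 * (C2 * \<bar>t\<bar>)"
          using \<psi>d kd \<psi>01[of w] C1[OF wB(2)] \<eta> by (intro add_mono mult_mono) auto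
        finally show ?thesis using wB by (simp add: algebra_simps)
      qed
    qed
  qed
  moreover have "(\<lambda>t. \<integral>w. F (w + t *\<^sub>R b) \<partial>lborel) = (\<lambda>t. \<integral>w. F w \<partial>lborel)"
    by (simp add: integral_lborel_translation[OF intF])
  ultimately have "((\<lambda>t::real. \<integral>w. F w \<partial>lborel) has_real_derivative (\<integral>w. f' w \<partial>lborel)) (at 0)"
    by simp
  from DERIV_unique[OF this DERIV_const] show ?thesis
    by (simp add: f'_def)
qed


text \<open>Summing the previous identity over the coordinates \<open>g w \<bullet> b\<close>, each
  in its own direction \<open>b\<close>, produces the divergence. For a gradient field the right
  side sees only the Laplacian under a nonnegative weight; for a constant field it says that the
  ball is centred at 0.\<close>

lemma integral_weighted_divergence:
  fixes g :: "'a::euclidean_space \<Rightarrow> 'a"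
  assumes "\<rho> > 1"
    and der: "\<And>x. x \<in> ball 0 \<rho> \<Longrightarrow> (g has_derivative H x) (at x)"
    and cont: "\<And>v. continuous_on (ball 0 \<rho>) (\<lambda>x. H x v)"
  shows "(\<integral>w. indicator (cball 0 1) w * (w \<bullet> g w) \<partial>lborel) =
    (\<integral>w. indicator (cball 0 1) w * ((1 - (norm w)\<^sup>2) * (\<Sum>b\<in>Basis. H w b \<bullet> b)) \<partial>lborel) / 2"
proof -
  have sub: "cball 0 1 \<subseteq> ball (0::'a) \<rho>" using \<open>\<rho> > 1\<close> by auto
  have gc: "continuous_on (cball 0 1) g"
    using der sub
    by (meson continuous_at_imp_continuous_on has_derivative_continuous subsetD)
  have Hc: "continuous_on (cball 0 1) (\<lambda>x. H x v)" for v
    using continuous_on_subset[OF cont sub] .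
  let ?I = "indicator (cball (0::'a) 1) :: 'a \<Rightarrow> real"
  have int1: "integrable lborel (\<lambda>w. ?I w * (w \<bullet> g w))"
    using borel_integrable_compact[of "cball 0 1" "\<lambda>w. w \<bullet> g w"] gc by (simp add: continuous_intros)
  have int2: "integrable lborel (\<lambda>w. ?I w * ((1 - (norm w)\<^sup>2) * (\<Sum>b\<in>Basis. H w b \<bullet> b)))"
    using borel_integrable_compact[of "cball 0 1" "\<lambda>w. (1 - (norm w)\<^sup>2) * (\<Sum>b\<in>Basis. H w b \<bullet> b)"] Hc
    by (simp add: continuous_intros)
  have int3: "integrable lborel (\<lambda>w. ?I w * ((1 - (norm w)\<^sup>2) * (H w b \<bullet> b) - 2 * (w \<bullet> b) * (g w \<bullet> b)))" for b
    using borel_integrable_compact[of "cball 0 1"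
        "\<lambda>w. (1 - (norm w)\<^sup>2) * (H w b \<bullet> b) - 2 * (w \<bullet> b) * (g w \<bullet> b)"] Hc gc
    by (simp add: continuous_intros)
  have "(\<integral>w. ?I w * ((1 - (norm w)\<^sup>2) * (H w b \<bullet> b) - 2 * (w \<bullet> b) * (g w \<bullet> b)) \<partial>lborel) = 0"
    if "b \<in> Basis" for b
  proof (rule integral_weighted_partial_derivative[OF \<open>\<rho> > 1\<close>, where K = "\<lambda>x v. H x v \<bullet> b"])
    show "norm b = 1" using that by simp
    show "((\<lambda>w. g w \<bullet> b) has_derivative (\<lambda>v. H x v \<bullet> b)) (at x)" if "x \<in> ball 0 \<rho>" for x
      by (intro has_derivative_inner_left der that)
  qed (auto intro!: continuous_intros cont)
  then have "0 = (\<Sum>b\<in>Basis. \<integral>w. ?I w * ((1 - (norm w)\<^sup>2) * (H w b \<bullet> b) - 2 * (w \<bullet> b) * (g w \<bullet> b)) \<partial>lborel)"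
    by simp
  also have "\<dots> = (\<integral>w. (\<Sum>b\<in>Basis. ?I w * ((1 - (norm w)\<^sup>2) * (H w b \<bullet> b) - 2 * (w \<bullet> b) * (g w \<bullet> b))) \<partial>lborel)"
    using int3 by (subst Bochner_Integration.integral_sum) auto
  also have "\<dots> = (\<integral>w. ?I w * ((1 - (norm w)\<^sup>2) * (\<Sum>b\<in>Basis. H w b \<bullet> b)) - 2 * (?I w * (w \<bullet> g w)) \<partial>lborel)"
  proof (intro Bochner_Integration.integral_cong refl)
    fix w :: 'a
    show "(\<Sum>b\<in>Basis. ?I w * ((1 - (norm w)\<^sup>2) * (H w b \<bullet> b) - 2 * (w \<bullet> b) * (g w \<bullet> b))) =
        ?I w * ((1 - (norm w)\<^sup>2) * (\<Sum>b\<in>Basis. H w b \<bullet> b)) - 2 * (?I w * (w \<bullet> g w))"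
      unfolding euclidean_inner[of w "g w"] sum_distrib_left[symmetric] sum_subtractf mult.assoc
      by (simp only: right_diff_distrib mult.left_commute)
  qed
  also have "\<dots> = (\<integral>w. ?I w * ((1 - (norm w)\<^sup>2) * (\<Sum>b\<in>Basis. H w b \<bullet> b)) \<partial>lborel)
      - 2 * (\<integral>w. ?I w * (w \<bullet> g w) \<partial>lborel)"
    using int1 int2 by simp
  finally show ?thesis by simp
qed

section \<open>Ball averages of superharmonic functions\<close>

text \<open>The Hessian \<open>H\<close> stays hidden because only its trace enters the estimates.
  The gradient \<open>g\<close> is exposed because the product and chain rules for \<open>l\<close>
  involve it.\<close>

definition has_laplacian_on ::
  "'a::euclidean_space set \<Rightarrow> ('a \<Rightarrow> real) \<Rightarrow> ('a \<Rightarrow> 'a) \<Rightarrow> ('a \<Rightarrow> real) \<Rightarrow> bool" where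
  "has_laplacian_on S u g l \<longleftrightarrow>
    (\<forall>x\<in>S. (u has_derivative (\<lambda>v. g x \<bullet> v)) (at x)) \<and>
    (\<exists>H. (\<forall>x\<in>S. (g has_derivative H x) (at x)) \<and> (\<forall>v. continuous_on S (\<lambda>x. H x v)) \<and>
         (\<forall>x\<in>S. l x = (\<Sum>b\<in>Basis. H x b \<bullet> b)))"

lemma has_laplacian_on_subset:
  "has_laplacian_on S u g l \<Longrightarrow> T \<subseteq> S \<Longrightarrow> has_laplacian_on T u g l"
  unfolding has_laplacian_on_def by (meson continuous_on_subset subsetD)

lemma has_laplacian_on_imp_continuous:
  "has_laplacian_on S u g l \<Longrightarrow> continuous_on S u"
  unfolding has_laplacian_on_def
  by (meson continuous_at_imp_continuous_on has_derivative_continuous)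

text \<open>The derivative of the integral in the radius \<open>t\<close> is the integral of
  \<open>w \<bullet> g (x + t *\<^sub>R w)\<close>. The weighted divergence formula turns this into
  a nonnegative weight against \<open>t * l\<close>, so the average decreases from its value
  \<open>u x\<close> at radius 0.\<close>

lemma superharmonic_ball_integral_le:
  fixes u :: "'a::euclidean_space \<Rightarrow> real"
  assumes lap: "has_laplacian_on (ball x r) u g l"
    and neg: "\<And>y. y \<in> ball x r \<Longrightarrow> l y \<le> 0"
    and s: "0 \<le> s" "s < r"
  shows "(\<integral>w. indicator (cball 0 1) w * u (x + s *\<^sub>R w) \<partial>lborel) \<le>
    (\<integral>w. indicator (cball (0::'a) 1) w * u x \<partial>lborel)"
proof -
  let ?I = "indicator (cball (0::'a) 1) :: 'a \<Rightarrow> real"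
  have du: "\<And>y. y \<in> ball x r \<Longrightarrow> (u has_derivative (\<lambda>v. g y \<bullet> v)) (at y)"
    using lap by (auto simp: has_laplacian_on_def)
  obtain H where dg: "\<And>y. y \<in> ball x r \<Longrightarrow> (g has_derivative H y) (at y)"
    and Hc: "\<And>v. continuous_on (ball x r) (\<lambda>x. H x v)"
    and l: "\<And>y. y \<in> ball x r \<Longrightarrow> l y = (\<Sum>b\<in>Basis. H y b \<bullet> b)"
    using lap unfolding has_laplacian_on_def by blast
  have gc: "continuous_on (ball x r) g"
    using dg by (meson continuous_at_imp_continuous_on has_derivative_continuous)
  have uc: "continuous_on (ball x r) u"
    by (rule has_laplacian_on_imp_continuous[OF lap])
  have inb: "x + t *\<^sub>R w \<in> ball x r" if "\<bar>t\<bar> < r" "w \<in> cball 0 1" for t w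
  proof -
    have "\<bar>t\<bar> * norm w \<le> \<bar>t\<bar> * 1" using that by (intro mult_left_mono) auto
    then show ?thesis using that by (simp add: dist_norm)
  qed
  have inb': "x + t *\<^sub>R w \<in> cball x q" if "\<bar>t\<bar> \<le> q" "w \<in> cball 0 1" for t q w
  proof -
    have "\<bar>t\<bar> * norm w \<le> \<bar>t\<bar> * 1" using that by (intro mult_left_mono) auto
    then show ?thesis using that by (simp add: dist_norm)
  qed
  define A where "A t = (\<integral>w. ?I w * u (x + t *\<^sub>R w) \<partial>lborel)" for t
  have dirder: "((\<lambda>t. u (x + t *\<^sub>R w)) has_real_derivative g (x + t *\<^sub>R w) \<bullet> w) (at t within T)"
    if "x + t *\<^sub>R w \<in> ball x r" for w t T
  proof -
    have "((\<lambda>t. u (x + t *\<^sub>R w)) has_derivative (\<lambda>h. g (x + t *\<^sub>R w) \<bullet> (h *\<^sub>R w))) (at t within T)"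
      by (rule has_derivative_compose[where f = "\<lambda>t. x + t *\<^sub>R w" and g = u, OF _ du[OF that]])
        (auto intro!: derivative_eq_intros)
    then show ?thesis by (simp add: has_field_derivative_def mult_commute_abs)
  qed
  have "\<exists>y. DERIV A t :> y \<and> y \<le> 0" if t: "0 \<le> t" "t \<le> s" for t
  proof (intro exI conjI)
    have tr: "t < r" using t s by simp
    define d where "d = (r - t) / 2"
    have d: "d > 0" "t + d < r" using tr by (auto simp: d_def field_simps)
    have sub: "cball x (t + d) \<subseteq> ball x r" using d by auto
    obtain C where C: "\<And>y. y \<in> cball x (t + d) \<Longrightarrow> norm (g y) \<le> C"
      using compact_imp_bounded[OF compact_continuous_image[OF continuous_on_subset[OF gc sub] compact_cball]]
      by (auto simp: bounded_iff simp del: mem_cball)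
    have comp: "continuous_on (cball 0 1) (\<lambda>w. u (x + \<tau> *\<^sub>R w))"
        "continuous_on (cball 0 1) (\<lambda>w. g (x + \<tau> *\<^sub>R w))" if "\<bar>\<tau>\<bar> < r" for \<tau>
      using that by (intro continuous_on_compose2[OF uc] continuous_on_compose2[OF gc] continuous_intros;
          auto intro: inb)+
    have int: "integrable lborel (\<lambda>w. ?I w * u (x + \<tau> *\<^sub>R w))" if "\<bar>\<tau>\<bar> < r" for \<tau>
      using borel_integrable_compact[OF _ comp(1)[OF that]] by simp
    have gint: "integrable lborel (\<lambda>w. ?I w * (w \<bullet> g (x + t *\<^sub>R w)))"
      using borel_integrable_compact[OF _ continuous_on_inner[OF continuous_on_id comp(2)], of t] t tr by simp
    show "DERIV A t :> (\<integral>w. ?I w * (w \<bullet> g (x + t *\<^sub>R w)) \<partial>lborel)"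
      unfolding A_def
    proof (rule DERIV_lebesgue_integral[OF d(1), where C = "\<lambda>w. ?I w *\<^sub>R C"])
      show "integrable lborel (\<lambda>w. ?I w * u (x + \<tau> *\<^sub>R w))" if "\<bar>\<tau> - t\<bar> < d" for \<tau>
        using that d t by (intro int) auto
      show "AE w in lborel. ((\<lambda>t. ?I w * u (x + t *\<^sub>R w)) has_real_derivative
          ?I w * (w \<bullet> g (x + t *\<^sub>R w))) (at t)"
      proof (rule AE_I2)
        fix w :: 'a
        show "((\<lambda>t. ?I w * u (x + t *\<^sub>R w)) has_real_derivative ?I w * (w \<bullet> g (x + t *\<^sub>R w))) (at t)"
        proof (cases "w \<in> cball 0 1")
          case True
          then show ?thesis using dirder[OF inb, of t w] t tr by (simp add: inner_commute)
        qed auto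
      qed
      show "\<bar>?I w * u (x + \<tau> *\<^sub>R w) - ?I w * u (x + t *\<^sub>R w)\<bar> \<le> ?I w *\<^sub>R C * \<bar>\<tau> - t\<bar>"
        if \<tau>: "\<bar>\<tau> - t\<bar> < d" for \<tau> w
      proof (cases "w \<in> cball 0 1")
        case True
        have "norm (u (x + \<tau> *\<^sub>R w) - u (x + t *\<^sub>R w)) \<le> C * norm (\<tau> - t)"
        \<comment> \<open>The interval is symmetric about 0 because the perturbed radius may be
          negative when \<open>t\<close> is small.\<close>
        proof (rule field_differentiable_bound[where S = "{-(t+d)..t+d}" and f' = "\<lambda>\<tau>. g (x + \<tau> *\<^sub>R w) \<bullet> w"])
          show "((\<lambda>\<tau>. u (x + \<tau> *\<^sub>R w)) has_real_derivative g (x + z *\<^sub>R w) \<bullet> w) (at z within {- (t + d)..t + d})"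
            if "z \<in> {- (t + d)..t + d}" for z
            using that True d by (intro dirder inb) auto
          show "norm (g (x + z *\<^sub>R w) \<bullet> w) \<le> C" if "z \<in> {- (t + d)..t + d}" for z
          proof -
            have "norm (g (x + z *\<^sub>R w)) \<le> C"
              using that True by (intro C inb') auto
            then have "norm (g (x + z *\<^sub>R w)) * norm w \<le> C * 1"
              using True by (intro mult_mono) (auto intro: order_trans[OF norm_ge_zero])
            then show ?thesis
              using Cauchy_Schwarz_ineq2[of "g (x + z *\<^sub>R w)" w] by simp
          qed
        qed (use \<tau> t d in auto)
        then show ?thesis using True by simp
      qed simp
      show "integrable lborel (\<lambda>w. ?I w *\<^sub>R C)"
        by (rule borel_integrable_compact) auto
      show "(\<lambda>w. ?I w * (w \<bullet> g (x + t *\<^sub>R w))) \<in> borel_measurable lborel"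
        using gint by (rule borel_measurable_integrable)
    qed
    have "(\<integral>w. ?I w * (w \<bullet> g (x + t *\<^sub>R w)) \<partial>lborel) =
        (\<integral>w. ?I w * ((1 - (norm w)\<^sup>2) * (\<Sum>b\<in>Basis. (t *\<^sub>R H (x + t *\<^sub>R w) b) \<bullet> b)) \<partial>lborel) / 2"
    \<comment> \<open>Dividing by \<open>t + d\<close> instead of \<open>t\<close> covers
      \<open>t = 0\<close> as well and still sends the enlarged ball into
      \<open>ball x r\<close>.\<close>
    proof (rule integral_weighted_divergence[where \<rho> = "r / (t + d)"])
      show "r / (t + d) > 1" using d t by simp
      have inb2: "x + t *\<^sub>R w \<in> ball x r" if "w \<in> ball 0 (r / (t + d))" for w
      proof -
        have "t * norm w \<le> (t + d) * norm w" using d t by (intro mult_right_mono) auto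
        also have "\<dots> < r" using that d t by (simp add: field_simps)
        finally show ?thesis using t by (simp add: dist_norm)
      qed
      show "((\<lambda>w. g (x + t *\<^sub>R w)) has_derivative (\<lambda>v. t *\<^sub>R H (x + t *\<^sub>R w) v)) (at w)"
        if "w \<in> ball 0 (r / (t + d))" for w
      proof -
        have "((\<lambda>w. g (x + t *\<^sub>R w)) has_derivative (\<lambda>v. H (x + t *\<^sub>R w) (t *\<^sub>R v))) (at w)"
          by (rule has_derivative_compose[where f = "\<lambda>w. x + t *\<^sub>R w" and g = g, OF _ dg[OF inb2[OF that]]])
            (auto intro!: derivative_eq_intros)
        then show ?thesis
          using linear_scale[OF has_derivative_linear[OF dg[OF inb2[OF that]]]] by simp
      qed
      show "continuous_on (ball 0 (r / (t + d))) (\<lambda>w. t *\<^sub>R H (x + t *\<^sub>R w) v)" for v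
        by (intro continuous_intros continuous_on_compose2[OF Hc[of v]]) (auto intro: inb2)
    qed
    also have "\<dots> \<le> 0"
    proof -
      have "?I w * ((1 - (norm w)\<^sup>2) * (\<Sum>b\<in>Basis. (t *\<^sub>R H (x + t *\<^sub>R w) b) \<bullet> b)) \<le> 0" for w
      proof (cases "w \<in> cball 0 1")
        case True
        have "(\<Sum>b\<in>Basis. (t *\<^sub>R H (x + t *\<^sub>R w) b) \<bullet> b) = t * l (x + t *\<^sub>R w)"
          using l[OF inb[OF _ True, of t]] t tr by (simp add: sum_distrib_left)
        moreover have "t * l (x + t *\<^sub>R w) \<le> 0"
          using neg[OF inb[OF _ True, of t]] t tr by (simp add: mult_nonneg_nonpos)
        moreover have "0 \<le> 1 - (norm w)\<^sup>2" using True by (simp add: power_le_one)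
        ultimately show ?thesis using True by (simp add: mult_nonneg_nonpos)
      qed simp
      then have "0 \<le> (\<integral>w. - (?I w * ((1 - (norm w)\<^sup>2) * (\<Sum>b\<in>Basis. (t *\<^sub>R H (x + t *\<^sub>R w) b) \<bullet> b))) \<partial>lborel)"
        by (intro Bochner_Integration.integral_nonneg) (simp only: neg_0_le_iff_le)
      then show ?thesis by simp
    qed
    finally show "(\<integral>w. ?I w * (w \<bullet> g (x + t *\<^sub>R w)) \<partial>lborel) \<le> 0" .
  qed
  then have "A s \<le> A 0"
    by (intro DERIV_nonpos_imp_nonincreasing[OF s(1)]) auto
  then show ?thesis by (simp add: A_def)
qed

lemma emeasure_lborel_unit_ball_nonzero: "emeasure lborel (ball (0::'a::euclidean_space) 1) \<noteq> 0"
  using content_ball_pos[of 1 "0::'a"] by (auto simp: measure_def)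

lemma prob_space_ball_space: "prob_space (ball_space :: 'a::euclidean_space measure)"
  unfolding ball_space_def
  by (rule prob_space_uniform_measure)
    (use emeasure_lborel_ball_finite[of "0::'a" 1] emeasure_lborel_unit_ball_nonzero in auto)

lemma sets_ball_space [measurable_cong, simp]: "sets (ball_space :: 'a::euclidean_space measure) = sets borel"
  by (simp add: ball_space_def)

lemma space_ball_space [simp]: "space (ball_space :: 'a::euclidean_space measure) = UNIV"
  by (simp add: ball_space_def)

text \<open>Nothing is assumed about derivatives on the bounding sphere. The previous lemma applies
  to the radii \<open>s n < r\<close>, and since \<open>u\<close> is continuous on the open ball and
  nonnegative, Fatou's lemma passes to the radius \<open>r\<close>.\<close>

lemma superharmonic_mean_le:
  fixes u :: "'a::euclidean_space \<Rightarrow> real"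
  assumes lap: "has_laplacian_on (ball x r) u g l"
    and neg: "\<And>y. y \<in> ball x r \<Longrightarrow> l y \<le> 0"
    and pos: "\<And>y. 0 \<le> u y"
    and [measurable]: "u \<in> borel_measurable borel"
    and "r > 0"
  shows "(\<integral>\<^sup>+w. ennreal (u (x + r *\<^sub>R w)) \<partial>ball_space) \<le> ennreal (u x)"
proof -
  define B where "B = ball (0::'a) 1"
  let ?I = "indicator (cball (0::'a) 1) :: 'a \<Rightarrow> real"
  have [measurable]: "B \<in> sets borel" by (simp add: B_def)
  define s where "s n = r * (real n / real (Suc n))" for n
  have s: "0 \<le> s n" "s n < r" for n
    using \<open>r > 0\<close> by (auto simp: s_def divide_simps)
  have slim: "s \<longlonglongrightarrow> r"
    unfolding s_def using tendsto_mult[OF tendsto_const LIMSEQ_n_over_Suc_n, of r] by simp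
  have uc: "continuous_on (ball x r) u"
    by (rule has_laplacian_on_imp_continuous[OF lap])
  have inb: "x + t *\<^sub>R w \<in> ball x r" if "0 \<le> t" "t < r" "norm w \<le> 1" for t w
  proof -
    have "\<bar>t\<bar> * norm w \<le> \<bar>t\<bar> * 1" using that by (intro mult_left_mono) auto
    then show ?thesis using that by (simp add: dist_norm)
  qed
  have le: "(\<integral>\<^sup>+w. ennreal (u (x + s n *\<^sub>R w)) * indicator B w \<partial>lborel) \<le> ennreal (u x) * emeasure lborel B" for n
  proof -
    have "continuous_on (cball 0 1) (\<lambda>w. u (x + s n *\<^sub>R w))"
      using s by (intro continuous_on_compose2[OF uc] continuous_intros) (auto intro!: inb)
    from borel_integrable_compact[OF _ this]
    have int: "integrable lborel (\<lambda>w. ?I w * u (x + s n *\<^sub>R w))" by simp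
    have "(\<integral>\<^sup>+w. ennreal (u (x + s n *\<^sub>R w)) * indicator B w \<partial>lborel) \<le>
        (\<integral>\<^sup>+w. ennreal (?I w * u (x + s n *\<^sub>R w)) \<partial>lborel)"
      by (intro nn_integral_mono) (auto simp: B_def indicator_def)
    also have "\<dots> = ennreal (\<integral>w. ?I w * u (x + s n *\<^sub>R w) \<partial>lborel)"
      using pos by (intro nn_integral_eq_integral int) auto
    also have "\<dots> \<le> ennreal (\<integral>w. ?I w * u x \<partial>lborel)"
      by (intro ennreal_leI superharmonic_ball_integral_le[OF lap neg s])
    also have "\<dots> = ennreal (u x) * ennreal (measure lborel (cball (0::'a) 1))"
      by (simp add: ennreal_mult pos mult.commute)
    also have "ennreal (measure lborel (cball (0::'a) 1)) = emeasure lborel (cball (0::'a) 1)"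
      using emeasure_lborel_cball_finite[of "0::'a" 1] by (simp add: emeasure_eq_ennreal_measure)
    also have "\<dots> = emeasure lborel B"
      by (simp add: B_def emeasure_ball emeasure_cball)
    finally show ?thesis .
  qed
  have "(\<integral>\<^sup>+w. ennreal (u (x + r *\<^sub>R w)) * indicator B w \<partial>lborel) =
      (\<integral>\<^sup>+w. liminf (\<lambda>n. ennreal (u (x + s n *\<^sub>R w)) * indicator B w) \<partial>lborel)"
  proof (intro nn_integral_cong)
    fix w :: 'a
    show "ennreal (u (x + r *\<^sub>R w)) * indicator B w = liminf (\<lambda>n. ennreal (u (x + s n *\<^sub>R w)) * indicator B w)"
    proof (cases "w \<in> B")
      case True
      then have "x + r *\<^sub>R w \<in> ball x r" using \<open>r > 0\<close> by (simp add: B_def dist_norm)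
      then have "isCont u (x + r *\<^sub>R w)" using uc by (simp add: continuous_on_eq_continuous_at)
      moreover have "(\<lambda>n. x + s n *\<^sub>R w) \<longlonglongrightarrow> x + r *\<^sub>R w"
        by (intro tendsto_intros slim)
      ultimately have "(\<lambda>n. u (x + s n *\<^sub>R w)) \<longlonglongrightarrow> u (x + r *\<^sub>R w)"
        by (rule isCont_tendsto_compose)
      then have "(\<lambda>n. ennreal (u (x + s n *\<^sub>R w))) \<longlonglongrightarrow> ennreal (u (x + r *\<^sub>R w))"
        by (rule tendsto_ennrealI)
      then show ?thesis using True by (simp add: lim_imp_Liminf)
    qed (simp add: Liminf_const)
  qed
  also have "\<dots> \<le> liminf (\<lambda>n. \<integral>\<^sup>+w. ennreal (u (x + s n *\<^sub>R w)) * indicator B w \<partial>lborel)"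
    by (rule nn_integral_liminf) measurable
  also have "\<dots> \<le> liminf (\<lambda>n. ennreal (u x) * emeasure lborel B)"
    by (intro Liminf_mono always_eventually allI le)
  also have "\<dots> = ennreal (u x) * emeasure lborel B"
    by (simp add: Liminf_const)
  finally have main: "(\<integral>\<^sup>+w. ennreal (u (x + r *\<^sub>R w)) * indicator B w \<partial>lborel) \<le> ennreal (u x) * emeasure lborel B" .
  have "(\<integral>\<^sup>+w. ennreal (u (x + r *\<^sub>R w)) \<partial>ball_space) =
      (\<integral>\<^sup>+w. ennreal (u (x + r *\<^sub>R w)) * indicator B w \<partial>lborel) / emeasure lborel B"
    unfolding ball_space_def B_def[symmetric] by (rule nn_integral_uniform_measure) measurable
  also have "\<dots> \<le> ennreal (u x) * emeasure lborel B / emeasure lborel B"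
    by (intro divide_right_mono_ennreal main)
  also have "\<dots> = ennreal (u x)"
    using emeasure_lborel_ball_finite[of "0::'a" 1]
    by (intro ennreal_mult_divide_eq) (auto simp: B_def emeasure_lborel_unit_ball_nonzero)
  finally show ?thesis .
qed

section \<open>A barrier outside a cone\<close>

lemma has_laplacian_on_cong:
  "has_laplacian_on S u g l \<Longrightarrow> (\<And>x. x \<in> S \<Longrightarrow> l x = l' x) \<Longrightarrow> has_laplacian_on S u g l'"
  unfolding has_laplacian_on_def by metis

lemma has_laplacian_on_inner:
  "has_laplacian_on S (\<lambda>x. (x - y) \<bullet> e) (\<lambda>_. e) (\<lambda>_. 0)"
  unfolding has_laplacian_on_def
  by (intro conjI ballI exI[of _ "\<lambda>_ _. 0"])
    (auto intro!: derivative_eq_intros simp: inner_commute)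

lemma has_laplacian_on_square:
  fixes S :: "'a::euclidean_space set"
  shows "has_laplacian_on S (\<lambda>x. (x - y) \<bullet> (x - y)) (\<lambda>x. 2 *\<^sub>R (x - y)) (\<lambda>_. 2 * real DIM('a))"
  unfolding has_laplacian_on_def
  by (intro conjI ballI exI[of _ "\<lambda>_ v. 2 *\<^sub>R v"])
    (auto intro!: derivative_eq_intros simp: inner_commute)

lemma has_laplacian_on_diff:
  assumes "has_laplacian_on S u g l" "has_laplacian_on S v k m"
  shows "has_laplacian_on S (\<lambda>x. u x - v x) (\<lambda>x. g x - k x) (\<lambda>x. l x - m x)"
proof -
  obtain H where H: "\<And>x. x \<in> S \<Longrightarrow> (g has_derivative H x) (at x)"
      "\<And>v. continuous_on S (\<lambda>x. H x v)" "\<And>x. x \<in> S \<Longrightarrow> l x = (\<Sum>b\<in>Basis. H x b \<bullet> b)"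
    using assms(1) unfolding has_laplacian_on_def by blast
  obtain K where K: "\<And>x. x \<in> S \<Longrightarrow> (k has_derivative K x) (at x)"
      "\<And>v. continuous_on S (\<lambda>x. K x v)" "\<And>x. x \<in> S \<Longrightarrow> m x = (\<Sum>b\<in>Basis. K x b \<bullet> b)"
    using assms(2) unfolding has_laplacian_on_def by blast
  show ?thesis
    unfolding has_laplacian_on_def
  proof (intro conjI ballI exI[of _ "\<lambda>x v. H x v - K x v"] allI)
    show "((\<lambda>x. u x - v x) has_derivative (\<lambda>v. (g x - k x) \<bullet> v)) (at x)" if "x \<in> S" for x
      using assms that by (auto simp: has_laplacian_on_def inner_diff_left intro!: has_derivative_diff)
  qed (use H K in \<open>auto intro!: has_derivative_diff continuous_intros simp: inner_diff_left sum_subtractf\<close>)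
qed

lemma has_laplacian_on_mult:
  assumes u: "has_laplacian_on S u g l" and v: "has_laplacian_on S v k m"
  shows "has_laplacian_on S (\<lambda>x. u x * v x) (\<lambda>x. u x *\<^sub>R k x + v x *\<^sub>R g x)
    (\<lambda>x. u x * m x + v x * l x + 2 * (g x \<bullet> k x))"
proof -
  have du: "\<And>x. x \<in> S \<Longrightarrow> (u has_derivative (\<lambda>h. g x \<bullet> h)) (at x)"
    and dv: "\<And>x. x \<in> S \<Longrightarrow> (v has_derivative (\<lambda>h. k x \<bullet> h)) (at x)"
    using assms by (auto simp: has_laplacian_on_def)
  obtain H where H: "\<And>x. x \<in> S \<Longrightarrow> (g has_derivative H x) (at x)"
      "\<And>v. continuous_on S (\<lambda>x. H x v)" "\<And>x. x \<in> S \<Longrightarrow> l x = (\<Sum>b\<in>Basis. H x b \<bullet> b)"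
    using assms(1) unfolding has_laplacian_on_def by blast
  obtain K where K: "\<And>x. x \<in> S \<Longrightarrow> (k has_derivative K x) (at x)"
      "\<And>v. continuous_on S (\<lambda>x. K x v)" "\<And>x. x \<in> S \<Longrightarrow> m x = (\<Sum>b\<in>Basis. K x b \<bullet> b)"
    using assms(2) unfolding has_laplacian_on_def by blast
  have c: "continuous_on S g" "continuous_on S k" "continuous_on S u" "continuous_on S v"
    using H(1) K(1) has_laplacian_on_imp_continuous[OF u] has_laplacian_on_imp_continuous[OF v]
    by (meson continuous_at_imp_continuous_on has_derivative_continuous)+
  define J where "J x h = (u x *\<^sub>R K x h + (g x \<bullet> h) *\<^sub>R k x) + (v x *\<^sub>R H x h + (k x \<bullet> h) *\<^sub>R g x)" for x h
  show ?thesis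
    unfolding has_laplacian_on_def
  proof (intro conjI ballI exI[of _ J] allI)
    fix x assume x: "x \<in> S"
    show "((\<lambda>x. u x * v x) has_derivative (\<lambda>h. (u x *\<^sub>R k x + v x *\<^sub>R g x) \<bullet> h)) (at x)"
      by (rule has_derivative_eq_rhs[OF has_derivative_mult[OF du[OF x] dv[OF x]]])
        (auto simp: inner_add_left algebra_simps)
    show "((\<lambda>x. u x *\<^sub>R k x + v x *\<^sub>R g x) has_derivative J x) (at x)"
      unfolding J_def
      by (intro has_derivative_add has_derivative_scaleR du dv H K x)
    show "u x * m x + v x * l x + 2 * (g x \<bullet> k x) = (\<Sum>b\<in>Basis. J x b \<bullet> b)"
      unfolding J_def H(3)[OF x] K(3)[OF x] euclidean_inner[of "g x" "k x"]
      by (simp add: inner_add_left sum.distrib sum_distrib_left algebra_simps)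
  next
    fix h show "continuous_on S (\<lambda>x. J x h)"
      unfolding J_def using c H K by (intro continuous_intros) auto
  qed
qed

lemma has_laplacian_on_compose:
  assumes u: "has_laplacian_on S u g l"
    and \<phi>: "\<And>x. x \<in> S \<Longrightarrow> (\<phi> has_real_derivative \<phi>' (u x)) (at (u x))"
    and \<phi>': "\<And>x. x \<in> S \<Longrightarrow> (\<phi>' has_real_derivative \<phi>'' (u x)) (at (u x))"
    and \<phi>'': "continuous_on (u ` S) \<phi>''"
  shows "has_laplacian_on S (\<lambda>x. \<phi> (u x)) (\<lambda>x. \<phi>' (u x) *\<^sub>R g x)
    (\<lambda>x. \<phi>' (u x) * l x + \<phi>'' (u x) * (norm (g x))\<^sup>2)"
proof -
  have du: "\<And>x. x \<in> S \<Longrightarrow> (u has_derivative (\<lambda>h. g x \<bullet> h)) (at x)"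
    using assms by (auto simp: has_laplacian_on_def)
  obtain H where H: "\<And>x. x \<in> S \<Longrightarrow> (g has_derivative H x) (at x)"
      "\<And>v. continuous_on S (\<lambda>x. H x v)" "\<And>x. x \<in> S \<Longrightarrow> l x = (\<Sum>b\<in>Basis. H x b \<bullet> b)"
    using assms(1) unfolding has_laplacian_on_def by blast
  have d\<phi>: "((\<lambda>x. \<phi> (u x)) has_derivative (\<lambda>h. (g x \<bullet> h) * \<phi>' (u x))) (at x)"
    and d\<phi>': "((\<lambda>x. \<phi>' (u x)) has_derivative (\<lambda>h. (g x \<bullet> h) * \<phi>'' (u x))) (at x)" if "x \<in> S" for x
    using has_derivative_compose[OF du[OF that] \<phi>[OF that, unfolded has_field_derivative_def]]
      has_derivative_compose[OF du[OF that] \<phi>'[OF that, unfolded has_field_derivative_def]]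
    by (simp_all add: mult.commute)
  have c: "continuous_on S g" "continuous_on S (\<lambda>x. \<phi>' (u x))" "continuous_on S (\<lambda>x. \<phi>'' (u x))"
    using H(1) d\<phi>' continuous_on_compose2[OF \<phi>'' has_laplacian_on_imp_continuous[OF u]]
    by (auto intro!: continuous_at_imp_continuous_on intro: has_derivative_continuous)
  define J where "J x h = \<phi>' (u x) *\<^sub>R H x h + ((g x \<bullet> h) * \<phi>'' (u x)) *\<^sub>R g x" for x h
  show ?thesis
    unfolding has_laplacian_on_def
  proof (intro conjI ballI exI[of _ J] allI)
    fix x assume x: "x \<in> S"
    show "((\<lambda>x. \<phi> (u x)) has_derivative (\<lambda>h. (\<phi>' (u x) *\<^sub>R g x) \<bullet> h)) (at x)"
      using d\<phi>[OF x] by (simp add: mult.commute)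
    show "((\<lambda>x. \<phi>' (u x) *\<^sub>R g x) has_derivative J x) (at x)"
      unfolding J_def by (intro has_derivative_scaleR d\<phi>' H x)
    show "\<phi>' (u x) * l x + \<phi>'' (u x) * (norm (g x))\<^sup>2 = (\<Sum>b\<in>Basis. J x b \<bullet> b)"
      unfolding J_def H(3)[OF x] power2_norm_eq_inner euclidean_inner[of "g x" "g x"]
      by (simp add: inner_add_left sum.distrib sum_distrib_left algebra_simps)
  next
    fix h show "continuous_on S (\<lambda>x. J x h)"
      unfolding J_def using c H by (intro continuous_intros) auto
  qed
qed

section \<open>Laplacians of the logarithmic radius and of the cosine of the angle\<close>

text \<open>Half the logarithm is composed with the squared distance, a polynomial, so the norm
  itself is never differentiated.\<close>

lemma has_laplacian_on_ln_norm:
  fixes y0 :: "'a::euclidean_space"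
  shows "has_laplacian_on (- {y0}) (\<lambda>x. ln (norm (x - y0))) (\<lambda>x. (x - y0) /\<^sub>R (norm (x - y0))\<^sup>2)
    (\<lambda>x. (real DIM('a) - 2) / (norm (x - y0))\<^sup>2)"
proof -
  have "has_laplacian_on (- {y0}) (\<lambda>x. (\<lambda>t. ln t / 2) ((x - y0) \<bullet> (x - y0)))
      (\<lambda>x. (\<lambda>t. 1 / (2 * t)) ((x - y0) \<bullet> (x - y0)) *\<^sub>R 2 *\<^sub>R (x - y0))
      (\<lambda>x. (\<lambda>t. 1 / (2 * t)) ((x - y0) \<bullet> (x - y0)) * (2 * real DIM('a)) +
        (\<lambda>t. - 1 / (2 * t\<^sup>2)) ((x - y0) \<bullet> (x - y0)) * (norm (2 *\<^sub>R (x - y0)))\<^sup>2)"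
    by (rule has_laplacian_on_compose[OF has_laplacian_on_square])
      (auto intro!: derivative_eq_intros continuous_intros simp: power2_eq_square field_simps)
  moreover have "(\<lambda>x. ln ((x - y0) \<bullet> (x - y0)) / 2) = (\<lambda>x. ln (norm (x - y0)))"
    by (auto simp: fun_eq_iff norm_eq_sqrt_inner ln_sqrt)
  moreover have "(\<lambda>x. (1 / (2 * ((x - y0) \<bullet> (x - y0)))) *\<^sub>R 2 *\<^sub>R (x - y0)) =
      (\<lambda>x. (x - y0) /\<^sub>R (norm (x - y0))\<^sup>2)"
    by (auto simp: fun_eq_iff power2_norm_eq_inner field_simps)
  ultimately have "has_laplacian_on (- {y0}) (\<lambda>x. ln (norm (x - y0))) (\<lambda>x. (x - y0) /\<^sub>R (norm (x - y0))\<^sup>2)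
      (\<lambda>x. 1 / (2 * ((x - y0) \<bullet> (x - y0))) * (2 * real DIM('a)) +
        - 1 / (2 * ((x - y0) \<bullet> (x - y0))\<^sup>2) * (norm (2 *\<^sub>R (x - y0)))\<^sup>2)"
    by simp
  then show ?thesis
  proof (rule has_laplacian_on_cong)
    fix x assume "x \<in> - {y0}"
    moreover define d where "d = x - y0"
    ultimately have "norm d \<noteq> 0" by auto
    then show "1 / (2 * ((x - y0) \<bullet> (x - y0))) * (2 * real DIM('a)) +
        - 1 / (2 * ((x - y0) \<bullet> (x - y0))\<^sup>2) * (norm (2 *\<^sub>R (x - y0)))\<^sup>2 =
        (real DIM('a) - 2) / (norm (x - y0))\<^sup>2"
      unfolding d_def[symmetric] power2_norm_eq_inner[symmetric]
      by (simp add: power_mult_distrib divide_simps power2_eq_square algebra_simps)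
  qed
qed

text \<open>\<open>q\<close> is the degree-one spherical harmonic, which explains the factor
  \<open>1 - DIM('a)\<close>. It is constant along rays, so its gradient is orthogonal to the
  radius; the length of the gradient is the sine of the angle over the distance. Besides the
  Laplacian, the barrier needs only these two facts about \<open>g\<close>.\<close>

lemma has_laplacian_on_cos_angle:
  fixes y0 e :: "'a::euclidean_space"
  assumes e: "norm e = 1"
  defines "q \<equiv> \<lambda>x. (x - y0) \<bullet> e / norm (x - y0)"
  obtains g where
    "has_laplacian_on (- {y0}) q g (\<lambda>x. (1 - real DIM('a)) * q x / (norm (x - y0))\<^sup>2)"
    "\<And>x. x \<noteq> y0 \<Longrightarrow> (norm (g x))\<^sup>2 = (1 - (q x)\<^sup>2) / (norm (x - y0))\<^sup>2"
    "\<And>x. x \<noteq> y0 \<Longrightarrow> g x \<bullet> (x - y0) = 0"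
proof -
  \<comment> \<open>Away from \<open>y0\<close> this is the reciprocal distance, written so that the
    chain rule applies to the logarithm.\<close>
  define s where "s x = exp (- ln (norm (x - y0)))" for x
  have s: "s x = 1 / norm (x - y0)" if "x \<noteq> y0" for x
    using that by (simp add: s_def exp_minus inverse_eq_divide)
  define gs where "gs x = (- s x) *\<^sub>R ((x - y0) /\<^sub>R (norm (x - y0))\<^sup>2)" for x
  have "has_laplacian_on (- {y0}) s gs (\<lambda>x. - s x * ((real DIM('a) - 2) / (norm (x - y0))\<^sup>2)
      + s x * (norm ((x - y0) /\<^sub>R (norm (x - y0))\<^sup>2))\<^sup>2)"
    unfolding s_def[abs_def] gs_def
    by (rule has_laplacian_on_compose[OF has_laplacian_on_ln_norm])
      (auto intro!: derivative_eq_intros continuous_intros)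
  from has_laplacian_on_mult[OF has_laplacian_on_inner[of _ y0 e] this]
  have lap: "has_laplacian_on (- {y0}) (\<lambda>x. ((x - y0) \<bullet> e) * s x) (\<lambda>x. ((x - y0) \<bullet> e) *\<^sub>R gs x + s x *\<^sub>R e)
      (\<lambda>x. ((x - y0) \<bullet> e) * (- s x * ((real DIM('a) - 2) / (norm (x - y0))\<^sup>2)
      + s x * (norm ((x - y0) /\<^sub>R (norm (x - y0))\<^sup>2))\<^sup>2) + s x * 0 + 2 * (e \<bullet> gs x))" .
  \<comment> \<open>The functions agree at \<open>y0\<close> too: both are 0 there, since division
    by zero gives 0.\<close>
  have q: "(\<lambda>x. ((x - y0) \<bullet> e) * s x) = q"
  proof
    show "((x - y0) \<bullet> e) * s x = q x" for x by (cases "x = y0") (auto simp: s q_def)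
  qed
  show ?thesis
  proof
    show "has_laplacian_on (- {y0}) q (\<lambda>x. ((x - y0) \<bullet> e) *\<^sub>R gs x + s x *\<^sub>R e)
        (\<lambda>x. (1 - real DIM('a)) * q x / (norm (x - y0))\<^sup>2)"
      using lap unfolding q
    proof (rule has_laplacian_on_cong)
      fix x assume "x \<in> - {y0}"
      then have x: "x \<noteq> y0" by simp
      define d where "d = x - y0"
      have d: "norm d \<noteq> 0" using x by (simp add: d_def)
      show "((x - y0) \<bullet> e) * (- s x * ((real DIM('a) - 2) / (norm (x - y0))\<^sup>2)
          + s x * (norm ((x - y0) /\<^sub>R (norm (x - y0))\<^sup>2))\<^sup>2) + s x * 0 + 2 * (e \<bullet> gs x) =
          (1 - real DIM('a)) * q x / (norm (x - y0))\<^sup>2"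
        unfolding q_def gs_def s[OF x] d_def[symmetric] using d
        by (simp add: inner_commute[of e d] power_mult_distrib divide_simps power2_eq_square algebra_simps)
    qed
    fix x assume x: "x \<noteq> y0"
    define d where "d = x - y0"
    have d: "norm d \<noteq> 0" using x by (simp add: d_def)
    have dd: "d \<bullet> d = norm d * norm d" by (simp add: dot_square_norm power2_eq_square)
    have ee: "e \<bullet> e = 1" using e by (simp add: dot_square_norm)
    have g: "((x - y0) \<bullet> e) *\<^sub>R gs x + s x *\<^sub>R e = (1 / norm d) *\<^sub>R e - ((d \<bullet> e) / (norm d)^3) *\<^sub>R d"
      using d by (simp add: gs_def s[OF x] d_def[symmetric] power2_eq_square power3_eq_cube field_simps)
    show "(norm (((x - y0) \<bullet> e) *\<^sub>R gs x + s x *\<^sub>R e))\<^sup>2 = (1 - (q x)\<^sup>2) / (norm (x - y0))\<^sup>2"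
      unfolding g unfolding q_def d_def[symmetric] power2_norm_eq_inner[of "_ - _"] using d
      by (simp add: inner_diff inner_commute[of e d] dd ee power2_eq_square power3_eq_cube field_simps)
    show "(((x - y0) \<bullet> e) *\<^sub>R gs x + s x *\<^sub>R e) \<bullet> (x - y0) = 0"
      unfolding g unfolding d_def[symmetric] using d
      by (simp add: inner_diff inner_commute[of e d] dd power3_eq_cube)
  qed
qed


lemma abs_cos_angle_le_1:
  fixes d e :: "'a::real_inner"
  assumes "norm e = 1"
  shows "\<bar>d \<bullet> e / norm d\<bar> \<le> 1"
proof (cases "d = 0")
  case False
  then show ?thesis
    using Cauchy_Schwarz_ineq2[of d e] assms by (simp add: divide_le_eq)
qed simp

text \<open>The barrier is \<open>exp (\<lambda> \<phi>)\<close> with \<open>\<phi> = ln |x - y0| - M exp (k cos \<theta>)\<close>, where \<open>\<theta>\<close> is the angle to the axis.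
  The constants are chosen so that \<open>\<Delta>\<phi> \<le> -1 / |x - y0|\<^sup>2\<close> outside the cone; then
  \<open>\<Delta> exp (\<lambda> \<phi>) = exp (\<lambda> \<phi>) (\<lambda> \<Delta>\<phi> + \<lambda>\<^sup>2 |\<nabla>\<phi>|\<^sup>2)\<close> is nonpositive for small \<open>\<lambda>\<close>.\<close>

lemma cone_barrier_exists:
  fixes y0 e :: "'a::euclidean_space"
  assumes e: "norm e = 1" and \<kappa>: "0 < \<kappa>" "\<kappa> < 1"
  obtains u g l p c where "p > 0" "c > 0" "has_laplacian_on (- {y0}) u g l"
    "\<And>x. x \<noteq> y0 \<Longrightarrow> (x - y0) \<bullet> e / norm (x - y0) \<le> \<kappa> \<Longrightarrow> l x \<le> 0"
    "\<And>x. x \<noteq> y0 \<Longrightarrow> c * norm (x - y0) powr p \<le> u x"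
    "\<And>x. x \<noteq> y0 \<Longrightarrow> u x \<le> norm (x - y0) powr p"
    "\<And>x. 0 \<le> u x" "u \<in> borel_measurable borel"
proof -
  define N where "N = real DIM('a)"
  have N: "N = 1 \<or> N \<ge> 2"
  proof -
    have "DIM('a) = 1 \<or> DIM('a) \<ge> 2" using DIM_positive[where 'a='a] by linarith
    then show ?thesis by (auto simp: N_def)
  qed
  define q where "q = (\<lambda>x. (x - y0) \<bullet> e / norm (x - y0))"
  have q1: "\<bar>q x\<bar> \<le> 1" for x
    unfolding q_def by (rule abs_cos_angle_le_1[OF e])
  obtain gq where lq: "has_laplacian_on (- {y0}) q gq (\<lambda>x. (1 - N) * q x / (norm (x - y0))\<^sup>2)"
    and nq: "\<And>x. x \<noteq> y0 \<Longrightarrow> (norm (gq x))\<^sup>2 = (1 - (q x)\<^sup>2) / (norm (x - y0))\<^sup>2"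
    and oq: "\<And>x. x \<noteq> y0 \<Longrightarrow> gq x \<bullet> (x - y0) = 0"
    using has_laplacian_on_cos_angle[OF e, of y0] unfolding q_def N_def by blast
  \<comment> \<open>Chosen so that \<open>k * (1 - \<kappa>\<^sup>2) = N * \<kappa>\<close>: then
    \<open>k * (1 - (q x)\<^sup>2) - (N - 1) * q x\<close> is at least \<kappa> when
    \<open>q x\<close> lies between -\<kappa> and \<kappa>. Below -\<kappa> the linear term alone
    suffices if \<open>N \<ge> 2\<close>.\<close>
  define k where "k = N * \<kappa> / (1 - \<kappa>\<^sup>2)"
  have \<kappa>2: "\<kappa>\<^sup>2 < 1" using \<kappa> by (simp add: power_less_one_iff)
  have k: "k > 0" using N \<kappa> \<kappa>2 by (auto simp: k_def)
  \<comment> \<open>Since \<open>exp (k * q x) \<ge> exp (- k)\<close>, this makes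
    \<open>M * k * exp (k * q x) * \<kappa>\<close> at least \<open>N - 1\<close>, one more than the
    coefficient \<open>N - 2\<close> contributed by the logarithm.\<close>
  define M where "M = (N - 1) * exp k / (k * \<kappa>)"
  have M: "M \<ge> 0" using N \<kappa> k by (auto simp: M_def)
  define \<phi> where "\<phi> x = ln (norm (x - y0)) - M * exp (k * q x)" for x
  define g where "g x = (x - y0) /\<^sub>R (norm (x - y0))\<^sup>2 - (M * k * exp (k * q x)) *\<^sub>R gq x" for x
  define l where "l x = (N - 2) / (norm (x - y0))\<^sup>2 -
    (M * k * exp (k * q x) * ((1 - N) * q x / (norm (x - y0))\<^sup>2) + M * k\<^sup>2 * exp (k * q x) * (norm (gq x))\<^sup>2)" for x
  have "has_laplacian_on (- {y0}) (\<lambda>x. M * exp (k * q x)) (\<lambda>x. (M * k * exp (k * q x)) *\<^sub>R gq x)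
      (\<lambda>x. M * k * exp (k * q x) * ((1 - N) * q x / (norm (x - y0))\<^sup>2) + M * k\<^sup>2 * exp (k * q x) * (norm (gq x))\<^sup>2)"
    by (rule has_laplacian_on_compose[OF lq, where \<phi> = "\<lambda>t. M * exp (k * t)"])
      (auto intro!: derivative_eq_intros continuous_intros simp: power2_eq_square)
  from has_laplacian_on_diff[OF has_laplacian_on_ln_norm this]
  have l\<phi>: "has_laplacian_on (- {y0}) \<phi> g l"
    unfolding \<phi>_def[abs_def] g_def[abs_def] l_def[abs_def] N_def .
  \<comment> \<open>Bound for \<open>(norm (g x))\<^sup>2\<close> times the squared distance: 1 from
    the radial part, the rest from the angular part. The exponent \<open>p = 1 / C\<close> then lets
    the gradient term exactly absorb \<open>l x \<le> - 1 / (norm (x - y0))\<^sup>2\<close>.\<close>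
  define C where "C = 1 + (M * k * exp k)\<^sup>2"
  have C: "C > 0" by (simp add: C_def add_pos_nonneg)
  define p where "p = 1 / C"
  have p: "p > 0" using C by (simp add: p_def)
  have l_le: "l x \<le> - 1 / (norm (x - y0))\<^sup>2" if x: "x \<noteq> y0" and qx: "q x \<le> \<kappa>" for x
  proof -
    have "N - 1 \<le> M * k * exp (k * q x) * (k * (1 - (q x)\<^sup>2) - (N - 1) * q x)"
    \<comment> \<open>In dimension one \<open>M\<close> is 0, and the logarithm alone has Laplacian
      \<open>- 1 / (norm (x - y0))\<^sup>2\<close>.\<close>
    proof (cases "N = 1")
      case True
      then show ?thesis by (simp add: M_def)
    next
      case False
      then have N2: "N \<ge> 2" using N by auto
      have b: "\<kappa> \<le> k * (1 - (q x)\<^sup>2) - (N - 1) * q x"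
      proof (cases "q x \<le> - \<kappa>")
        case True
        have "1 * \<kappa> \<le> (N - 1) * (- q x)" using True N2 \<kappa> by (intro mult_mono) auto
        moreover have "0 \<le> k * (1 - (q x)\<^sup>2)"
          using q1[of x] k by (simp add: abs_square_le_1)
        ultimately show ?thesis by simp
      next
        case False
        then have "\<bar>q x\<bar> \<le> \<bar>\<kappa>\<bar>" using qx by auto
        then have "(q x)\<^sup>2 \<le> \<kappa>\<^sup>2" by (simp add: abs_le_square_iff)
        then have "k * (1 - \<kappa>\<^sup>2) \<le> k * (1 - (q x)\<^sup>2)" using k by (intro mult_left_mono) auto
        moreover have "k * (1 - \<kappa>\<^sup>2) = N * \<kappa>" using \<kappa>2 by (simp add: k_def)
        moreover have "(N - 1) * q x \<le> (N - 1) * \<kappa>" using qx N2 by (intro mult_left_mono) auto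
        ultimately show ?thesis by (simp add: algebra_simps)
      qed
      have "1 \<le> exp (k + k * q x)"
      proof -
        have "k * (- 1) \<le> k * q x" using q1[of x] k by (intro mult_left_mono) auto
        then show ?thesis by simp
      qed
      then have "(N - 1) * 1 \<le> (N - 1) * exp (k + k * q x)" using N2 by (intro mult_left_mono) auto
      also have "\<dots> = M * k * exp (k * q x) * \<kappa>"
        using k \<kappa> by (simp add: M_def exp_add)
      also have "\<dots> \<le> M * k * exp (k * q x) * (k * (1 - (q x)\<^sup>2) - (N - 1) * q x)"
        using b M k by (intro mult_left_mono) auto
      finally show ?thesis by simp
    qed
    moreover have "l x = (N - 2 - M * k * exp (k * q x) * (k * (1 - (q x)\<^sup>2) - (N - 1) * q x)) / (norm (x - y0))\<^sup>2"
      unfolding l_def nq[OF x] by (simp add: diff_divide_distrib add_divide_distrib algebra_simps power2_eq_square)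
    ultimately show ?thesis by (simp only:) (intro divide_right_mono, auto)
  qed
  have g_le: "(norm (g x))\<^sup>2 \<le> C / (norm (x - y0))\<^sup>2" if x: "x \<noteq> y0" for x
  proof -
    define d where "d = x - y0"
    have d: "norm d \<noteq> 0" using x by (simp add: d_def)
    define m where "m = M * k * exp (k * q x)"
    have m: "0 \<le> m" "m \<le> M * k * exp k"
    proof -
      have "k * q x \<le> k * 1" using q1[of x] k by (intro mult_left_mono) auto
      then show "m \<le> M * k * exp k" unfolding m_def using M k by (intro mult_left_mono) auto
    qed (use M k in \<open>simp add: m_def\<close>)
    \<comment> \<open>Pythagoras: the radial and the angular part of the gradient are orthogonal by
      \<open>oq\<close>.\<close>
    have "(norm (g x))\<^sup>2 = (norm (d /\<^sub>R (norm d)\<^sup>2))\<^sup>2 + m\<^sup>2 * (norm (gq x))\<^sup>2"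
      unfolding g_def d_def[symmetric] m_def[symmetric] power2_norm_eq_inner
      using oq[OF x, folded d_def]
      by (simp add: inner_diff inner_commute[of d "gq x"] power2_eq_square)
    also have "(norm (d /\<^sub>R (norm d)\<^sup>2))\<^sup>2 = 1 / (norm d)\<^sup>2"
      using d by (simp add: power2_eq_square field_simps)
    also have "m\<^sup>2 * (norm (gq x))\<^sup>2 \<le> (M * k * exp k)\<^sup>2 * (1 / (norm d)\<^sup>2)"
      using m q1[of x] unfolding nq[OF x] d_def
      by (intro mult_mono power_mono divide_right_mono) (auto simp: abs_square_le_1)
    finally show ?thesis by (simp add: C_def d_def add_divide_distrib)
  qed
  define u where "u x = exp (p * \<phi> x)" for x
  have lu: "has_laplacian_on (- {y0}) u (\<lambda>x. (p * u x) *\<^sub>R g x) (\<lambda>x. p * u x * l x + p\<^sup>2 * u x * (norm (g x))\<^sup>2)"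
    unfolding u_def[abs_def]
    by (rule has_laplacian_on_compose[OF l\<phi>, where \<phi> = "\<lambda>t. exp (p * t)" and \<phi>' = "\<lambda>t. p * exp (p * t)"])
      (auto intro!: derivative_eq_intros continuous_intros simp: power2_eq_square)
  have u_eq: "u x = norm (x - y0) powr p * exp (- p * M * exp (k * q x))" if "x \<noteq> y0" for x
    using that by (simp add: u_def \<phi>_def powr_def exp_add[symmetric] algebra_simps)
  show ?thesis
  \<comment> \<open>By \<open>u_eq\<close> the angular factor of \<open>u\<close> is
    \<open>exp (- p * M * exp (k * q x))\<close>, which is at most 1 and at least this
    \<open>c\<close>, because \<open>q x \<le> 1\<close>.\<close>
  proof (rule that[OF p _ lu, where c = "exp (- p * M * exp k)"])
    fix x assume x: "x \<noteq> y0"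
    show "p * u x * l x + p\<^sup>2 * u x * (norm (g x))\<^sup>2 \<le> 0" if "(x - y0) \<bullet> e / norm (x - y0) \<le> \<kappa>"
    proof -
      have "p * (norm (g x))\<^sup>2 \<le> p * (C / (norm (x - y0))\<^sup>2)"
        using g_le[OF x] p by (intro mult_left_mono) auto
      also have "\<dots> = 1 / (norm (x - y0))\<^sup>2" using C by (simp add: p_def)
      finally have "l x + p * (norm (g x))\<^sup>2 \<le> 0"
        using l_le[OF x] that by (simp add: q_def)
      then have "p * u x * (l x + p * (norm (g x))\<^sup>2) \<le> 0"
        using p by (intro mult_nonneg_nonpos) (auto simp: u_def)
      then show ?thesis by (simp add: algebra_simps power2_eq_square)
    qed
    have "k * q x \<le> k * 1" using q1[of x] k by (intro mult_left_mono) auto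
    then have "p * M * exp (k * q x) \<le> p * M * exp k" using p M by (intro mult_left_mono) auto
    then show "exp (- p * M * exp k) * norm (x - y0) powr p \<le> u x"
      unfolding u_eq[OF x] by (subst mult.commute) (intro mult_left_mono, auto)
    have "norm (x - y0) powr p * exp (- p * M * exp (k * q x)) \<le> norm (x - y0) powr p * 1"
      using p M by (intro mult_left_mono) auto
    then show "u x \<le> norm (x - y0) powr p" by (simp add: u_eq[OF x])
  next
    show "0 \<le> u x" for x by (simp add: u_def)
    show "u \<in> borel_measurable borel"
      unfolding u_def[abs_def] \<phi>_def q_def by measurable
  qed simp
qed

section \<open>Random walks with state-dependent step size\<close>

interpretation ball_space: prob_space "ball_space :: 'a::euclidean_space measure"
  by (rule prob_space_ball_space)

interpretation walk: sequence_space "ball_space :: 'a::euclidean_space measure"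
  by unfold_locales

lemma prob_space_walk_space: "prob_space (walk_space :: (nat \<Rightarrow> 'a::euclidean_space) measure)"
  unfolding walk_space_def by (rule prob_space_PiM) (rule prob_space_ball_space)

interpretation walk_space: prob_space "walk_space :: (nat \<Rightarrow> 'a::euclidean_space) measure"
  by (rule prob_space_walk_space)

lemma space_walk_space [simp]: "space (walk_space :: (nat \<Rightarrow> 'a::euclidean_space) measure) = UNIV"
  by (simp add: walk_space_def space_PiM)

lemma measurable_walk_space_component:
  "(\<lambda>\<omega>. \<omega> i) \<in> borel_measurable (walk_space :: (nat \<Rightarrow> 'a::euclidean_space) measure)"
proof -
  have "(\<lambda>\<omega>. \<omega> i) \<in> measurable (walk_space :: (nat \<Rightarrow> 'a) measure) ball_space"
    unfolding walk_space_def by (rule measurable_component_singleton) simp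
  then show ?thesis by (simp add: measurable_cong_sets[OF refl sets_ball_space])
qed

lemma measurable_case_nat_walk_space:
  "(\<lambda>(w, \<omega>). case_nat w \<omega>) \<in> measurable (ball_space \<Otimes>\<^sub>M walk_space) (walk_space :: (nat \<Rightarrow> 'a::euclidean_space) measure)"
  unfolding walk_space_def by measurable

text \<open>Prepending an independent step to the sequence preserves its law; Fubini does the rest.
  This is the source of the Markov property.\<close>

lemma emeasure_walk_space_first_step:
  fixes A :: "(nat \<Rightarrow> 'a::euclidean_space) set"
  assumes A: "A \<in> sets walk_space"
  shows "emeasure walk_space A = (\<integral>\<^sup>+w. emeasure walk_space {\<omega>. case_nat w \<omega> \<in> A} \<partial>ball_space)"
proof -
  let ?f = "\<lambda>(w, \<omega>). case_nat w \<omega> :: nat \<Rightarrow> 'a"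
  have eq: "distr (ball_space \<Otimes>\<^sub>M walk_space) walk_space ?f = (walk_space :: (nat \<Rightarrow> 'a) measure)"
    using walk.PiM_iter unfolding walk_space_def .
  have "emeasure walk_space A = emeasure (distr (ball_space \<Otimes>\<^sub>M walk_space) walk_space ?f) A"
    by (simp only: eq)
  also have "\<dots> = emeasure (ball_space \<Otimes>\<^sub>M walk_space) (?f -` A)"
    using A by (subst emeasure_distr[OF measurable_case_nat_walk_space]) (simp_all add: space_pair_measure)
  also have "\<dots> = (\<integral>\<^sup>+w. emeasure walk_space (Pair w -` (?f -` A)) \<partial>ball_space)"
    using measurable_sets[OF measurable_case_nat_walk_space A]
    by (intro walk_space.emeasure_pair_measure_alt) (simp add: space_pair_measure)
  also have "\<dots> = (\<integral>\<^sup>+w. emeasure walk_space {\<omega>. case_nat w \<omega> \<in> A} \<partial>ball_space)"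
    by (simp add: vimage_def)
  finally show ?thesis .
qed

lemma AE_ball_space: "AE w in (ball_space :: 'a::euclidean_space measure). norm w < 1"
  unfolding ball_space_def
  by (rule AE_uniform_measureI) auto

text \<open>Reconciles two indexings: \<open>ball_walk\<close> skips \<open>\<omega> 0\<close>,
  whereas \<open>scaled_walk\<close> starts with it.\<close>

lemma distr_walk_space_shift:
  "distr walk_space walk_space (\<lambda>\<omega> n. \<omega> (Suc n)) = (walk_space :: (nat \<Rightarrow> 'a::euclidean_space) measure)"
  using distr_PiM_reindex[of UNIV "\<lambda>_. ball_space :: 'a measure" Suc UNIV]
  by (simp add: walk_space_def prob_space_ball_space restrict_UNIV)

text \<open>Expanding the square leaves a cross term linear in \<open>w\<close>, which vanishes
  because the ball is centred; \<open>c\<close> is the mean of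
  \<open>(norm w)\<^sup>2\<close>.\<close>

lemma ball_space_second_moment:
  obtains c :: real where "c \<ge> 0"
    "\<And>(a::'a::euclidean_space) t. (\<integral>\<^sup>+w. ennreal ((norm (a + t *\<^sub>R w))\<^sup>2) \<partial>ball_space) =
      ennreal ((norm a)\<^sup>2 + c * t\<^sup>2)"
proof -
  let ?M = "ball_space :: 'a measure"
  have bnd: "integrable ?M f" if [measurable]: "f \<in> borel_measurable borel"
    and f: "\<And>w. norm w < 1 \<Longrightarrow> \<bar>f w\<bar> \<le> C" for f :: "'a \<Rightarrow> real" and C
    using AE_ball_space f by (intro ball_space.integrable_const_bound[where B = C]) (auto elim: eventually_mono)
  have zero: "(\<integral>w. a \<bullet> w \<partial>?M) = 0" for a
  proof -
    have "(\<integral>w. a \<bullet> w \<partial>?M) = (\<integral>w. indicator (ball 0 1) w * (a \<bullet> w) \<partial>lborel) / measure lborel (ball (0::'a) 1)"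
    proof -
      have fin: "emeasure lborel (ball (0::'a) 1) = ennreal (measure lborel (ball (0::'a) 1))"
        using emeasure_lborel_ball_finite[of "0::'a" 1] by (simp add: emeasure_eq_ennreal_measure)
      have eq: "?M = density lborel (\<lambda>w. ennreal (indicator (ball 0 1) w / measure lborel (ball (0::'a) 1)))"
        unfolding ball_space_def uniform_measure_def fin
        using content_ball_pos[of 1 "0::'a"]
        by (intro density_cong) (auto simp: divide_ennreal indicator_def simp flip: ennreal_1)
      show ?thesis unfolding eq by (subst integral_density) (auto intro!: borel_measurable_divide borel_measurable_indicator)
    qed
    also have "(\<integral>w. indicator (ball 0 1) w * (a \<bullet> w) \<partial>lborel) = (\<integral>w. indicator (cball 0 1) w * (w \<bullet> a) \<partial>lborel)"
    proof (rule integral_cong_AE)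
      have "AE w in lborel. w \<notin> sphere (0::'a) 1"
        using negligible_sphere[of "0::'a" 1]
        by (intro AE_not_in) (simp add: negligible_iff_null_sets null_sets_completion_iff)
      then show "AE w in lborel. indicator (ball 0 1) w * (a \<bullet> w) = indicator (cball 0 1) w * (w \<bullet> a)"
        by eventually_elim (auto simp: indicator_def inner_commute)
    qed (auto intro!: borel_measurable_times borel_measurable_indicator)
    \<comment> \<open>The constant vector field \<open>a\<close> has divergence 0.\<close>
    also have "\<dots> = 0"
      using integral_weighted_divergence[of 2 "\<lambda>_. a" "\<lambda>_ _. 0"] by simp
    finally show ?thesis by simp
  qed
  define c where "c = (\<integral>w. (norm w)\<^sup>2 \<partial>?M)"
  have int2: "integrable ?M (\<lambda>w. (norm w)\<^sup>2)"
    by (rule bnd[where C = 1]) (auto simp: power_le_one)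
  have int1: "integrable ?M (\<lambda>w. a \<bullet> w)" for a
  proof (rule bnd[where C = "norm a"])
    fix w :: 'a assume "norm w < 1"
    then have "norm a * norm w \<le> norm a * 1" by (intro mult_left_mono) auto
    then show "\<bar>a \<bullet> w\<bar> \<le> norm a" using Cauchy_Schwarz_ineq2[of a w] by simp
  qed simp
  show ?thesis
  proof
    show "c \<ge> 0" unfolding c_def by simp
    fix a :: 'a and t :: real
    have expand: "(norm (a + t *\<^sub>R w))\<^sup>2 = (norm a)\<^sup>2 + 2 * t * (a \<bullet> w) + t\<^sup>2 * (norm w)\<^sup>2" for w
      unfolding power2_norm_eq_inner by (simp add: inner_add inner_commute power2_eq_square algebra_simps)
    have "(\<integral>\<^sup>+w. ennreal ((norm (a + t *\<^sub>R w))\<^sup>2) \<partial>?M) = ennreal (\<integral>w. (norm (a + t *\<^sub>R w))\<^sup>2 \<partial>?M)"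
      by (rule nn_integral_eq_integral) (use int1 int2 in \<open>simp add: expand\<close>, simp)
    also have "(\<integral>w. (norm (a + t *\<^sub>R w))\<^sup>2 \<partial>?M) = (norm a)\<^sup>2 + c * t\<^sup>2"
      unfolding expand using int1 int2 zero by (simp add: c_def ball_space.prob_space[simplified])
    finally show "(\<integral>\<^sup>+w. ennreal ((norm (a + t *\<^sub>R w))\<^sup>2) \<partial>?M) = ennreal ((norm a)\<^sup>2 + c * t\<^sup>2)" .
  qed
qed

section \<open>Maximal inequality and almost sure convergence\<close>

text \<open>Reading \<open>\<omega>\<close> from index 0 makes prepending with
  \<open>case_nat\<close> the same as taking one step first.\<close>

primrec scaled_walk :: "('a::euclidean_space \<Rightarrow> real) \<Rightarrow> 'a \<Rightarrow> (nat \<Rightarrow> 'a) \<Rightarrow> nat \<Rightarrow> 'a" where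
  "scaled_walk r x \<omega> 0 = x"
| "scaled_walk r x \<omega> (Suc n) = scaled_walk r x \<omega> n + r (scaled_walk r x \<omega> n) *\<^sub>R \<omega> n"

lemma scaled_walk_case_nat:
  "scaled_walk r x (case_nat w \<omega>) (Suc n) = scaled_walk r (x + r x *\<^sub>R w) \<omega> n"
  by (induction n) auto

lemma ball_walk_eq_scaled_walk:
  "ball_walk D \<epsilon> x \<omega> n = scaled_walk (\<lambda>y. min \<epsilon> (infdist y (frontier D))) x (\<lambda>n. \<omega> (Suc n)) n"
  by (induction n) auto

locale scaled_ball_walk =
  fixes D :: "'a::euclidean_space set" and r :: "'a \<Rightarrow> real"
  assumes measurable_r [measurable]: "r \<in> borel_measurable borel"
    and step_in: "\<And>x w. x \<in> D \<Longrightarrow> norm w < 1 \<Longrightarrow> x + r x *\<^sub>R w \<in> D"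
    and bounded_D: "bounded D"
begin

lemma measurable_scaled_walk [measurable]:
  "(\<lambda>\<omega>. scaled_walk r x \<omega> n) \<in> borel_measurable walk_space"
proof (induction n)
  case (Suc n)
  note Suc[measurable] measurable_walk_space_component[of n, measurable]
  show ?case unfolding scaled_walk.simps by measurable
qed simp

text \<open>The transition operator of the Markov chain of positions.\<close>

definition step_op :: "('a \<Rightarrow> ennreal) \<Rightarrow> 'a \<Rightarrow> ennreal" where
  "step_op f x = (\<integral>\<^sup>+w. f (x + r x *\<^sub>R w) \<partial>ball_space)"

lemma measurable_step_op [measurable]:
  assumes [measurable]: "f \<in> borel_measurable borel"
  shows "step_op f \<in> borel_measurable borel"
  unfolding step_op_def[abs_def] by measurable

lemma step_op_mono:
  assumes "x \<in> D" "\<And>y. y \<in> D \<Longrightarrow> f y \<le> g y"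
  shows "step_op f x \<le> step_op g x"
  unfolding step_op_def
  using AE_ball_space by (intro nn_integral_mono_AE) (auto elim!: eventually_mono intro!: assms step_in)

lemma step_op_add:
  assumes [measurable]: "f \<in> borel_measurable borel" "g \<in> borel_measurable borel"
  shows "step_op (\<lambda>y. f y + g y) x = step_op f x + step_op g x"
  unfolding step_op_def by (rule nn_integral_add) measurable

lemma step_op_divide:
  assumes [measurable]: "f \<in> borel_measurable borel"
  shows "step_op (\<lambda>y. f y / c) x = step_op f x / c"
  unfolding step_op_def by (rule nn_integral_divide) measurable

text \<open>Markov property: the path without its first point is the walk restarted from the random
  position after one step.\<close>

lemma emeasure_walk_first_step:
  assumes "{\<omega>. P (\<lambda>n. scaled_walk r x \<omega> (Suc n))} \<in> sets walk_space"
  shows "emeasure walk_space {\<omega>. P (\<lambda>n. scaled_walk r x \<omega> (Suc n))} =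
    step_op (\<lambda>y. emeasure walk_space {\<omega>. P (scaled_walk r y \<omega>)}) x"
  unfolding step_op_def emeasure_walk_space_first_step[OF assms] mem_Collect_eq scaled_walk_case_nat ..

text \<open>Doob's maximal inequality without stopping times. By induction on \<open>n\<close>, the
  probability of an exit up to time \<open>n\<close> is at most \<open>V\<close>: off
  \<open>G\<close> because \<open>V \<ge> 1\<close>, in \<open>G\<close> by one step, the induction
  hypothesis and \<open>step_op V y \<le> V y\<close>. Superharmonicity is needed only in
  \<open>G\<close>, which suits a local barrier.\<close>

lemma exit_prob_le:
  assumes [measurable]: "G \<in> sets borel"
    and sup: "\<And>y. y \<in> D \<Longrightarrow> y \<in> G \<Longrightarrow> step_op V y \<le> V y"
    and ge1: "\<And>y. y \<in> D \<Longrightarrow> y \<notin> G \<Longrightarrow> 1 \<le> V y"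
    and "x \<in> D"
  shows "emeasure walk_space {\<omega>. \<exists>n. scaled_walk r x \<omega> n \<notin> G} \<le> V x"
proof -
  define E where "E x n = {\<omega>. \<exists>m\<le>n. scaled_walk r x \<omega> m \<notin> G}" for x n
  have E_meas [measurable]: "E x n \<in> sets walk_space" for x n
  proof -
    have "{\<omega> \<in> space walk_space. \<exists>m\<le>n. scaled_walk r x \<omega> m \<notin> G} \<in> sets walk_space" by measurable
    then show ?thesis by (simp add: E_def)
  qed
  have le: "emeasure walk_space (E x n) \<le> V x" if "x \<in> D" for x n
    using that
  proof (induction n arbitrary: x)
    case 0
    then show ?case using ge1[of x] by (cases "x \<in> G") (auto simp: E_def walk_space.emeasure_space_1[simplified])
  next
    case (Suc n)
    show ?case
    proof (cases "x \<in> G")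
      case False
      then show ?thesis using ge1[of x] Suc.prems walk_space.emeasure_le_1 order_trans by blast
    next
      case True
      have eq: "E x (Suc n) = {\<omega>. \<exists>m\<le>n. scaled_walk r x \<omega> (Suc m) \<notin> G}" (is "_ = ?E")
        unfolding E_def
      proof (rule Collect_cong)
        show "(\<exists>m\<le>Suc n. scaled_walk r x \<omega> m \<notin> G) \<longleftrightarrow> (\<exists>m\<le>n. scaled_walk r x \<omega> (Suc m) \<notin> G)" for \<omega>
          using True by (metis Suc_le_mono not0_implies_Suc scaled_walk.simps(1))
      qed
      have "emeasure walk_space ?E = step_op (\<lambda>y. emeasure walk_space (E y n)) x"
        using emeasure_walk_first_step[of "\<lambda>X. \<exists>m\<le>n. X m \<notin> G" x] E_meas[of x "Suc n"]
        unfolding eq by (simp add: E_def)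
      also have "\<dots> \<le> step_op V x"
        by (rule step_op_mono[OF Suc.prems Suc.IH])
      also have "\<dots> \<le> V x" by (rule sup[OF Suc.prems True])
      finally show ?thesis by (simp only: eq)
    qed
  qed
  have "{\<omega>. \<exists>n. scaled_walk r x \<omega> n \<notin> G} = (\<Union>n. E x n)"
    by (auto simp: E_def)
  also have "emeasure walk_space \<dots> = (SUP n. emeasure walk_space (E x n))"
    using E_meas by (intro SUP_emeasure_incseq[symmetric]) (auto simp: incseq_def E_def intro: order_trans)
  also have "\<dots> \<le> V x"
    by (intro SUP_least le \<open>x \<in> D\<close>)
  finally show ?thesis .
qed

text \<open>The mean square displacement \<open>Q\<close> of the whole future path is finite because the walk is a
  martingale in a bounded set; with it, \<open>z \<mapsto> |z - x|\<^sup>2 + Q z\<close> is invariant, so the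
  maximal inequality turns \<open>Q\<close> into a bound on the oscillation of the path.\<close>

lemma energy_exists:
  obtains Q :: "'a \<Rightarrow> ennreal" where "Q \<in> borel_measurable borel" "\<And>x. x \<in> D \<Longrightarrow> Q x < \<infinity>"
    "\<And>x y. x \<in> D \<Longrightarrow> step_op (\<lambda>z. ennreal ((norm (z - y))\<^sup>2) + Q z) x \<le> ennreal ((norm (x - y))\<^sup>2) + Q x"
    "\<And>x. x \<in> D \<Longrightarrow> (INF n. (step_op ^^ n) Q x) = 0"
proof -
  obtain c where c: "c \<ge> 0"
    "\<And>(a::'a) t. (\<integral>\<^sup>+w. ennreal ((norm (a + t *\<^sub>R w))\<^sup>2) \<partial>ball_space) = ennreal ((norm a)\<^sup>2 + c * t\<^sup>2)"
    using ball_space_second_moment by metis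
  \<comment> \<open>Mean squared length of the next step.\<close>
  define e where "e x = ennreal (c * (r x)\<^sup>2)" for x
  have [measurable]: "e \<in> borel_measurable borel" unfolding e_def[abs_def] by measurable
  have sq: "step_op (\<lambda>z. ennreal ((norm (z - y))\<^sup>2)) x = ennreal ((norm (x - y))\<^sup>2) + e x" for x y
    using c(2)[of "x - y" "r x"] c(1) by (simp add: step_op_def e_def algebra_simps)
  obtain R where R: "\<And>x. x \<in> D \<Longrightarrow> norm x \<le> R"
    using bounded_D by (auto simp: bounded_iff)
  \<comment> \<open>On \<open>D\<close> the sum of \<open>K\<close> and the squared norm is
    constant, while \<open>step_op\<close> raises the squared norm by \<open>e\<close>; hence
    \<open>K\<close> loses exactly \<open>e\<close> per step. It serves as a finite bound for the
    total energy.\<close>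
  define K where "K x = ennreal (R\<^sup>2 - (norm x)\<^sup>2)" for x :: 'a
  have [measurable]: "K \<in> borel_measurable borel" unfolding K_def[abs_def] by measurable
  have K: "K x + ennreal ((norm (x - 0))\<^sup>2) = ennreal (R\<^sup>2)" if "x \<in> D" for x
    using power_mono[OF R[OF that] norm_ge_zero, of 2]
    by (simp add: K_def ennreal_plus[symmetric] del: ennreal_plus)
  have Ke: "e x + step_op K x = K x" if x: "x \<in> D" for x
  proof -
    have "(e x + step_op K x) + ennreal ((norm (x - 0))\<^sup>2) = step_op (\<lambda>z. K z + ennreal ((norm (z - 0))\<^sup>2)) x"
      by (subst step_op_add) (simp_all add: sq[of 0, simplified] ac_simps)
    also have "\<dots> = step_op (\<lambda>z. ennreal (R\<^sup>2)) x"
      using x K by (intro antisym step_op_mono) auto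
    also have "\<dots> = K x + ennreal ((norm (x - 0))\<^sup>2)"
      using K[OF x] by (simp add: step_op_def ball_space.emeasure_space_1[simplified])
    finally show ?thesis by (simp add: ennreal_add_left_cancel add.commute[of _ "ennreal _"])
  qed
  \<comment> \<open>Expected sum of \<open>e\<close> over the first \<open>n\<close> positions of
    the walk.\<close>
  define S where "S n = ((\<lambda>f x. e x + step_op f x) ^^ n) (\<lambda>_. 0)" for n
  have S0: "S 0 = (\<lambda>_. 0)" and SS: "S (Suc n) = (\<lambda>x. e x + step_op (S n) x)" for n
    by (simp_all add: S_def)
  have S_meas [measurable]: "S n \<in> borel_measurable borel" for n
    by (induction n) (simp_all add: S0 SS)
  have S_le: "S n x \<le> K x" if "x \<in> D" for n x
    using that
  proof (induction n arbitrary: x)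
    case (Suc n)
    have "S (Suc n) x \<le> e x + step_op K x"
      unfolding SS by (intro add_left_mono step_op_mono Suc)
    then show ?case by (simp add: Ke Suc.prems)
  qed (simp add: S0)
  have S_mono: "S n x \<le> S (Suc n) x" for n x
  proof (induction n arbitrary: x)
    case (Suc n)
    show ?case
      using Suc.IH unfolding SS[of "Suc n"] by (subst SS) (auto simp: step_op_def intro!: add_left_mono nn_integral_mono)
  qed (simp add: S0)
  define Q where "Q x = (SUP n. S n x)" for x
  have Q_meas [measurable]: "Q \<in> borel_measurable borel" unfolding Q_def[abs_def] by measurable
  have inc: "incseq (\<lambda>n. S n x)" for x by (intro incseq_SucI S_mono)
  have Q: "Q x = e x + step_op Q x" for x
  proof -
    have "step_op Q x = (SUP n. step_op (S n) x)"
      unfolding step_op_def Q_def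
      by (rule nn_integral_monotone_convergence_SUP)
        (auto simp: incseq_def le_fun_def intro: incseqD[OF inc])
    also have "e x + \<dots> = (SUP n. e x + step_op (S n) x)"
      by (simp add: ennreal_SUP_add_right)
    also have "\<dots> = (SUP n. S (Suc n) x)" by (simp add: SS)
    also have "\<dots> = Q x"
      unfolding Q_def by (intro antisym SUP_least) (rule SUP_upper, simp, rule order_trans[OF S_mono], rule SUP_upper, simp)
    finally show ?thesis by simp
  qed
  have Qn_meas [measurable]: "(step_op ^^ n) Q \<in> borel_measurable borel" for n
    by (induction n) simp_all
  have Qn: "Q x = S n x + (step_op ^^ n) Q x" for n x
  proof (induction n arbitrary: x)
    case (Suc n)
    have "Q x = e x + step_op (\<lambda>x. S n x + (step_op ^^ n) Q x) x"
      unfolding Suc.IH[symmetric] by (rule Q)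
    also have "\<dots> = S (Suc n) x + (step_op ^^ Suc n) Q x"
      by (simp add: step_op_add SS add.assoc)
    finally show ?case .
  qed (simp add: S0)
  have Q_fin: "Q x < \<infinity>" if "x \<in> D" for x
  proof -
    have "Q x \<le> K x" unfolding Q_def by (intro SUP_least S_le that)
    also have "\<dots> < \<infinity>" by (simp add: K_def)
    finally show ?thesis .
  qed
  show ?thesis
  proof (rule that[OF Q_meas Q_fin])
    show "step_op (\<lambda>z. ennreal ((norm (z - y))\<^sup>2) + Q z) x \<le> ennreal ((norm (x - y))\<^sup>2) + Q x" for x y
      by (subst step_op_add) (simp_all add: sq Q[of x] add.assoc)
    show "(INF n. (step_op ^^ n) Q x) = 0" if "x \<in> D" for x
    proof -
      \<comment> \<open>The iterates of \<open>step_op\<close> on \<open>Q\<close> are the tails of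
        the energy series; finiteness of \<open>Q x\<close> permits the subtraction and sends them
        to 0.\<close>
      have "(step_op ^^ n) Q x = Q x - S n x" for n
        using Qn[of x n] Q_fin[OF that]
        by (metis ennreal_add_diff_cancel_left ennreal_add_eq_top infinity_ennreal_def less_irrefl)
      then have "(INF n. (step_op ^^ n) Q x) = (INF n. Q x - S n x)" by simp
      also have "\<dots> = Q x - (SUP n. S n x)"
        using Q_fin[OF that] by (intro ennreal_SUP_const_minus) auto
      also have "\<dots> = 0" using Q_fin[OF that] by (simp add: Q_def[symmetric])
      finally show ?thesis .
    qed
  qed
qed

text \<open>The chance of moving by at least \<open>a\<close> at some time after \<open>n\<close> is
  at most the remaining mean energy \<open>(step_op ^^ n) Q x\<close> over the square of
  \<open>a\<close>. This tends to 0, so almost surely some \<open>n\<close> has no such later move;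
  taking \<open>a\<close> along reciprocals of integers gives the Cauchy property.\<close>

lemma AE_Cauchy_scaled_walk:
  assumes "x \<in> D"
  shows "AE \<omega> in walk_space. Cauchy (scaled_walk r x \<omega>)"
proof -
  obtain Q where Q_meas [measurable]: "Q \<in> borel_measurable borel"
    and "\<And>x. x \<in> D \<Longrightarrow> Q x < \<infinity>"
    and Q: "\<And>x y. x \<in> D \<Longrightarrow>
      step_op (\<lambda>z. ennreal ((norm (z - y))\<^sup>2) + Q z) x \<le> ennreal ((norm (x - y))\<^sup>2) + Q x"
    and Q0: "\<And>x. x \<in> D \<Longrightarrow> (INF n. (step_op ^^ n) Q x) = 0"
    by (rule energy_exists) (rule that)
  have Qn_meas [measurable]: "(step_op ^^ n) Q \<in> borel_measurable borel" for n
    by (induction n) simp_all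
  define E where "E a n x = {\<omega>. \<exists>m. a \<le> dist (scaled_walk r x \<omega> (n + m)) (scaled_walk r x \<omega> n)}"
    for a :: real and n x
  have E_meas [measurable]: "E a n x \<in> sets walk_space" for a n x
  proof -
    have "{\<omega> \<in> space walk_space. \<exists>m. a \<le> dist (scaled_walk r x \<omega> (n + m)) (scaled_walk r x \<omega> n)} \<in> sets walk_space"
      by measurable
    then show ?thesis by (simp add: E_def)
  qed
  have E_le: "emeasure walk_space (E a n x) \<le> (step_op ^^ n) Q x / ennreal (a\<^sup>2)"
    if "a > 0" "x \<in> D" for a n x
    using that(2)
  proof (induction n arbitrary: x)
    case 0
    \<comment> \<open>For time 0 the squared distance is centred at the starting point; later times
      follow by iterating the Markov property.\<close>
    define V where "V z = (ennreal ((norm (z - x))\<^sup>2) + Q z) / ennreal (a\<^sup>2)" for z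
    have "emeasure walk_space {\<omega>. \<exists>n. scaled_walk r x \<omega> n \<notin> ball x a} \<le> V x"
    proof (rule exit_prob_le)
      show "step_op V y \<le> V y" if "y \<in> D" for y
        unfolding V_def[abs_def] using Q[OF that, of x]
        by (subst step_op_divide) (auto intro!: divide_right_mono_ennreal)
      show "1 \<le> V y" if "y \<notin> ball x a" for y
      proof -
        have "a\<^sup>2 \<le> (norm (y - x))\<^sup>2"
          using that \<open>a > 0\<close> by (intro power_mono) (auto simp: dist_norm norm_minus_commute)
        then have "ennreal (a\<^sup>2) \<le> ennreal ((norm (y - x))\<^sup>2) + Q y"
          using ennreal_leI add_increasing2[OF zero_le] by blast
        then have "ennreal (a\<^sup>2) / ennreal (a\<^sup>2) \<le> V y"
          unfolding V_def by (rule divide_right_mono_ennreal)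
        then show ?thesis using \<open>a > 0\<close> by (simp add: divide_ennreal)
      qed
    qed (use 0 in auto)
    then show ?case by (simp add: V_def E_def not_less dist_commute)
  next
    case (Suc n)
    have "emeasure walk_space (E a (Suc n) x) = step_op (\<lambda>y. emeasure walk_space (E a n y)) x"
      using emeasure_walk_first_step[of "\<lambda>X. \<exists>m. a \<le> dist (X (n + m)) (X n)" x] E_meas[of a "Suc n" x]
      by (simp add: E_def del: scaled_walk.simps)
    also have "\<dots> \<le> step_op (\<lambda>y. (step_op ^^ n) Q y / ennreal (a\<^sup>2)) x"
      by (rule step_op_mono[OF Suc.prems Suc.IH])
    also have "\<dots> = (step_op ^^ Suc n) Q x / ennreal (a\<^sup>2)"
      by (simp add: step_op_divide)
    finally show ?case .
  qed
  have null: "AE \<omega> in walk_space. \<omega> \<notin> (\<Inter>n. E a n x)" if "a > 0" for a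
  proof (rule AE_not_in, rule null_setsI)
    have "emeasure walk_space (\<Inter>n. E a n x) \<le> (step_op ^^ n) Q x / ennreal (a\<^sup>2)" for n
      by (rule order_trans[OF emeasure_mono E_le[OF that \<open>x \<in> D\<close>]]) auto
    then have "emeasure walk_space (\<Inter>n. E a n x) \<le> (INF n. (step_op ^^ n) Q x / ennreal (a\<^sup>2))"
      by (intro INF_greatest)
    also have "\<dots> = 0"
    \<comment> \<open>A positive infimum, multiplied by the square of \<open>a\<close>, would be a
      positive lower bound for all the tails.\<close>
    proof (rule ccontr)
      let ?m = "INF n. (step_op ^^ n) Q x / ennreal (a\<^sup>2)"
      assume "?m \<noteq> 0"
      have "?m * ennreal (a\<^sup>2) \<le> (step_op ^^ n) Q x" for n
      proof -
        have "?m * ennreal (a\<^sup>2) \<le> (step_op ^^ n) Q x / ennreal (a\<^sup>2) * ennreal (a\<^sup>2)"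
          by (intro mult_right_mono INF_lower) auto
        also have "\<dots> = (step_op ^^ n) Q x"
          using that by (simp add: ennreal_divide_times ennreal_mult_divide_eq)
        finally show ?thesis .
      qed
      then have "?m * ennreal (a\<^sup>2) \<le> (INF n. (step_op ^^ n) Q x)" by (intro INF_greatest)
      then show False using Q0[OF \<open>x \<in> D\<close>] \<open>?m \<noteq> 0\<close> that by simp
    qed
    finally show "emeasure walk_space (\<Inter>n. E a n x) = 0" by simp
  qed measurable
  have "AE \<omega> in walk_space. \<forall>k. \<omega> \<notin> (\<Inter>n. E (inverse (real (Suc k))) n x)"
    by (subst AE_all_countable) (intro allI null, simp)
  then show ?thesis
  proof eventually_elim
    case (elim \<omega>)
    show ?case
      unfolding Cauchy_altdef2
    proof (intro allI impI)
      fix e :: real assume "e > 0"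
      then obtain k where k: "inverse (real (Suc k)) < e" using reals_Archimedean by blast
      obtain n where "\<omega> \<notin> E (inverse (real (Suc k))) n x" using elim by blast
      then have "dist (scaled_walk r x \<omega> (n + m)) (scaled_walk r x \<omega> n) < e" for m
        using k by (auto simp: E_def not_le intro: less_trans)
      then show "\<exists>N. \<forall>n\<ge>N. dist (scaled_walk r x \<omega> n) (scaled_walk r x \<omega> N) < e"
        by (metis le_Suc_ex)
    qed
  qed
qed

end

section \<open>Walk-regularity\<close>

text \<open>A segment leaving \<open>D\<close> crosses the frontier at a point no farther than its
  endpoint.\<close>

lemma ball_infdist_frontier_subset:
  fixes D :: "'a::euclidean_space set"
  assumes "x \<in> D"
  shows "ball x (infdist x (frontier D)) \<subseteq> D"
proof
  fix y assume y: "y \<in> ball x (infdist x (frontier D))"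
  show "y \<in> D"
  proof (rule ccontr)
    assume "y \<notin> D"
    then have "closed_segment x y \<inter> frontier D \<noteq> {}"
      using assms by (intro connected_Int_frontier) auto
    then obtain z where z: "z \<in> closed_segment x y" "z \<in> frontier D" by auto
    have "infdist x (frontier D) \<le> dist x z" by (rule infdist_le[OF z(2)])
    also have "\<dots> \<le> dist x y" using dist_in_closed_segment[OF z(1)] by (simp add: dist_commute)
    finally show False using y by simp
  qed
qed

lemma cos_angle_le_outside_finite_cone:
  assumes "norm e = 1" "0 < \<alpha>" "\<alpha> < pi / 2" "x \<notin> finite_cone y0 e h \<alpha>" "norm (x - y0) < h"
  shows "(x - y0) \<bullet> e / norm (x - y0) \<le> cos \<alpha>"
proof (rule ccontr)
  assume *: "\<not> ?thesis"
  have "x \<noteq> y0" using assms(4) by (auto simp: finite_cone_def)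
  have "arccos ((x - y0) \<bullet> e / norm (x - y0)) < arccos (cos \<alpha>)"
    using * abs_le_D1[OF abs_cos_angle_le_1[OF assms(1), of "x - y0"]] by (intro arccos_less_arccos) auto
  also have "arccos (cos \<alpha>) = \<alpha>" using assms by (intro arccos_cos) auto
  finally have "y0 + (x - y0) \<in> finite_cone y0 e h \<alpha>"
    using \<open>x \<noteq> y0\<close> assms(5) unfolding finite_cone_def by (intro insertI2 CollectI exI[of _ "x - y0"]) auto
  then show False using assms(4) by simp
qed

theorem theorem2p19:
  fixes D :: "'a::euclidean_space set" and y0 :: 'a
  assumes "open D" "bounded D" "connected D"
    and "y0 \<in> frontier D"
    and "exterior_cone_condition D y0"
  shows "walk_regular D y0"
proof -
  have y0D: "y0 \<notin> D"
    using assms(1,4) by (auto simp: frontier_def interior_open)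
  obtain e h \<alpha> where e: "norm e = 1" and h: "h > 0" and \<alpha>: "0 < \<alpha>" "\<alpha> < pi / 2"
    and cone: "finite_cone y0 e h \<alpha> \<subseteq> - D"
    using assms(5) unfolding exterior_cone_condition_def by blast
  define \<kappa> where "\<kappa> = cos \<alpha>"
  have \<kappa>: "0 < \<kappa>" "\<kappa> < 1"
    using \<alpha> cos_monotone_0_pi[of 0 \<alpha>] by (auto simp: \<kappa>_def intro: cos_gt_zero)
  have outside: "(x - y0) \<bullet> e / norm (x - y0) \<le> \<kappa>" if "x \<in> D" "norm (x - y0) < h" for x
    unfolding \<kappa>_def using that cone by (intro cos_angle_le_outside_finite_cone[OF e \<alpha>]) auto
  obtain u g l p c where p: "p > 0" and c: "c > 0" and lap: "has_laplacian_on (- {y0}) u g l"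
    and l: "\<And>x. x \<noteq> y0 \<Longrightarrow> (x - y0) \<bullet> e / norm (x - y0) \<le> \<kappa> \<Longrightarrow> l x \<le> 0"
    and u_ge: "\<And>x. x \<noteq> y0 \<Longrightarrow> c * norm (x - y0) powr p \<le> u x"
    and u_le: "\<And>x. x \<noteq> y0 \<Longrightarrow> u x \<le> norm (x - y0) powr p"
    and u0: "\<And>x. 0 \<le> u x" and [measurable]: "u \<in> borel_measurable borel"
    by (rule cone_barrier_exists[OF e \<kappa>, of y0]) (rule that)
  show ?thesis
    unfolding walk_regular_def
  proof (intro allI impI)
    fix \<eta> \<delta> :: real assume \<eta>: "\<eta> > 0" and \<delta>: "\<delta> > 0"
    \<comment> \<open>Strictly below \<delta>, because a limit of points in \<open>ball y0 R\<close>
      is only known to lie in the closed ball; at most \<open>h / 2\<close>, to leave room for one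
      step below the height of the cone.\<close>
    define R where "R = min \<delta> h / 2"
    have R: "R > 0" "R < \<delta>" "R \<le> h / 2" using \<delta> h by (auto simp: R_def)
    \<comment> \<open>Lower bound for the barrier on \<open>D\<close> outside
      \<open>ball y0 R\<close>; dividing by it gives the value at least 1 required by
      \<open>exit_prob_le\<close>.\<close>
    define m where "m = c * R powr p"
    have m: "m > 0" using c R by (simp add: m_def)
    \<comment> \<open>The second term solves \<open>\<delta>' powr p = \<eta> * m\<close>, so that
      \<open>u x0 / m \<le> \<eta>\<close> for every admissible start.\<close>
    define \<delta>' where "\<delta>' = min (R / 2) ((\<eta> * m) powr (1 / p))"
    have \<delta>': "0 < \<delta>'" "\<delta>' < R" using R \<eta> m by (auto simp: \<delta>'_def)
    have \<delta>'p: "\<delta>' powr p \<le> \<eta> * m"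
    proof -
      have "\<delta>' powr p \<le> ((\<eta> * m) powr (1 / p)) powr p"
        using \<delta>' p by (intro powr_mono2) (auto simp: \<delta>'_def)
      also have "\<dots> = \<eta> * m" using \<eta> m p by (simp add: powr_powr)
      finally show ?thesis .
    qed
    show "\<exists>\<delta>'. 0 < \<delta>' \<and> \<delta>' < \<delta> \<and> (\<exists>\<epsilon>'. 0 < \<epsilon>' \<and> \<epsilon>' < 1 \<and>
        (\<forall>\<epsilon>. 0 < \<epsilon> \<and> \<epsilon> < \<epsilon>' \<longrightarrow> (\<forall>x0 \<in> ball y0 \<delta>' \<inter> D. hit_prob D \<epsilon> x0 y0 \<delta> \<ge> 1 - \<eta>)))"
    \<comment> \<open>The bound \<open>h / 2\<close> keeps a step from \<open>ball y0 R\<close>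
      within distance \<open>h\<close> of \<open>y0\<close>; \<open>1/2\<close> secures the required
      bound by 1.\<close>
    proof (rule exI[of _ \<delta>'], intro exI[of _ "min (1/2) (h/2)"] conjI allI impI ballI)
      fix \<epsilon> x0 assume \<epsilon>: "0 < \<epsilon> \<and> \<epsilon> < min (1/2) (h/2)" and x0: "x0 \<in> ball y0 \<delta>' \<inter> D"
      define r where "r y = min \<epsilon> (infdist y (frontier D))" for y
      have r_pos: "r y > 0" if "y \<in> D" for y
      proof -
        have "y \<notin> frontier D" using that assms(1) by (auto simp: frontier_def interior_open)
        then have "infdist y (frontier D) > 0"
          using assms(4) by (intro infdist_pos_not_in_closed) auto
        then show ?thesis using \<epsilon> by (simp add: r_def)
      qed
      have ball_r: "ball y (r y) \<subseteq> D" if "y \<in> D" for y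
        using ball_infdist_frontier_subset[OF that] by (auto simp: r_def)
      interpret scaled_ball_walk D r
      proof
        show "r \<in> borel_measurable borel"
          unfolding r_def[abs_def]
          by (intro borel_measurable_continuous_onI continuous_intros)
        show "x + r x *\<^sub>R w \<in> D" if "x \<in> D" "norm w < 1" for x w
          using ball_r[OF that(1)] r_pos[OF that(1)] that(2) by (auto simp: dist_norm)
      qed (rule assms(2))
      let ?Y = "scaled_walk r x0"
      define V where "V z = ennreal (u z) / ennreal m" for z
      have exit: "emeasure walk_space {\<omega>. \<exists>n. ?Y \<omega> n \<notin> ball y0 R} \<le> V x0"
      proof (rule exit_prob_le)
        show "step_op V y \<le> V y" if y: "y \<in> D" "y \<in> ball y0 R" for y
        proof -
          have near: "z \<in> D \<and> norm (z - y0) < h" if "z \<in> ball y (r y)" for z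
          proof
            show "z \<in> D" using that ball_r[OF y(1)] by auto
            have "dist y z < \<epsilon>" using that by (auto simp: r_def)
            then show "norm (z - y0) < h"
              using y(2) R \<epsilon> dist_triangle[of y0 z y] by (simp add: dist_norm norm_minus_commute)
          qed
          have sub: "ball y (r y) \<subseteq> - {y0}" using near y0D by blast
          have "step_op (\<lambda>z. ennreal (u z)) y \<le> ennreal (u y)"
            unfolding step_op_def
          proof (rule superharmonic_mean_le[OF has_laplacian_on_subset[OF lap sub] _ u0 _ r_pos[OF y(1)]])
            show "l z \<le> 0" if "z \<in> ball y (r y)" for z
              using near[OF that] sub that by (intro l outside) auto
          qed measurable
          then show ?thesis
            unfolding V_def[abs_def] by (subst step_op_divide) (auto intro!: divide_right_mono_ennreal)
        qed
        show "1 \<le> V y" if "y \<in> D" "y \<notin> ball y0 R" for y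
        proof -
          have "m \<le> c * norm (y - y0) powr p"
            unfolding m_def using that c p R
            by (intro mult_left_mono powr_mono2) (auto simp: dist_norm norm_minus_commute)
          also have "\<dots> \<le> u y" using that y0D by (intro u_ge) auto
          finally show ?thesis using m by (simp add: V_def divide_ennreal u0 flip: ennreal_1)
        qed
      qed (use x0 in auto)
      have "u x0 \<le> \<eta> * m"
      proof -
        have "u x0 \<le> norm (x0 - y0) powr p" using x0 y0D by (intro u_le) auto
        also have "\<dots> \<le> \<delta>' powr p"
          using x0 p by (intro powr_mono2) (auto simp: dist_norm norm_minus_commute)
        finally show ?thesis using \<delta>'p by simp
      qed
      then have "V x0 \<le> ennreal \<eta>"
        using m u0 \<eta> by (simp add: V_def divide_ennreal divide_le_eq)
      have [measurable]: "ball y0 s \<in> sets borel" for s by simp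
      define E where "E = {\<omega>. \<exists>n. ?Y \<omega> n \<notin> ball y0 R}"
      have E_sets: "E \<in> sets walk_space"
      proof -
        have "{\<omega> \<in> space walk_space. \<exists>n. ?Y \<omega> n \<notin> ball y0 R} \<in> sets walk_space" by measurable
        then show ?thesis by (simp add: E_def)
      qed
      have E_prob: "measure walk_space E \<le> \<eta>"
        using order_trans[OF exit \<open>V x0 \<le> ennreal \<eta>\<close>] \<eta>
        by (simp add: E_def walk_space.emeasure_eq_measure)
      \<comment> \<open>Convergence is expressed by \<open>Cauchy\<close> and \<open>lim\<close> so
        that the event is visibly measurable; \<open>lim_iff\<close> identifies it with the
        existential form in \<open>hit_prob\<close>.\<close>
      define B where "B = {\<omega>. Cauchy (?Y \<omega>) \<and> lim (?Y \<omega>) \<in> ball y0 \<delta>}"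
      have B_sets: "B \<in> sets walk_space"
      proof -
        have "{\<omega> \<in> space walk_space. Cauchy (?Y \<omega>)} \<in> sets walk_space"
          by (rule sets_Collect_Cauchy[OF measurable_scaled_walk])
        moreover have "(\<lambda>\<omega>. lim (?Y \<omega>)) \<in> borel_measurable walk_space"
          by (rule borel_measurable_lim_metric[OF measurable_scaled_walk])
        then have "(\<lambda>\<omega>. lim (?Y \<omega>)) -` ball y0 \<delta> \<inter> space walk_space \<in> sets walk_space"
          by (rule measurable_sets) simp
        ultimately have "{\<omega> \<in> space walk_space. Cauchy (?Y \<omega>)} \<inter>
            ((\<lambda>\<omega>. lim (?Y \<omega>)) -` ball y0 \<delta> \<inter> space walk_space) \<in> sets walk_space"
          by (rule sets.Int)
        then show ?thesis by (simp add: B_def vimage_def Int_def)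
      qed
      have "AE \<omega> in walk_space. \<omega> \<in> - E \<longrightarrow> \<omega> \<in> B"
        using AE_Cauchy_scaled_walk[OF IntD2[OF x0]]
      proof eventually_elim
        case (elim \<omega>)
        show ?case
        proof
          assume "\<omega> \<in> - E"
          then have in_ball: "?Y \<omega> n \<in> ball y0 R" for n by (auto simp: E_def)
          have conv: "?Y \<omega> \<longlonglongrightarrow> lim (?Y \<omega>)"
            using elim by (simp add: Cauchy_convergent convergent_LIMSEQ_iff[symmetric])
          have "?Y \<omega> n \<in> cball y0 R" for n using in_ball[of n] by auto
          from closed_sequentially[OF closed_cball this conv] have "lim (?Y \<omega>) \<in> cball y0 R" .
          then show "\<omega> \<in> B" using elim R by (auto simp: B_def)
        qed
      qed
      then have "measure walk_space (- E) \<le> measure walk_space B"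
        using B_sets by (rule walk_space.finite_measure_mono_AE)
      moreover have "measure walk_space (- E) = 1 - measure walk_space E"
        using walk_space.prob_compl[OF E_sets] by (simp add: Compl_eq_Diff_UNIV)
      ultimately have B_prob: "measure walk_space B \<ge> 1 - \<eta>" using E_prob by simp
      \<comment> \<open>The event in \<open>hit_prob\<close> is the preimage of \<open>B\<close>
        under dropping \<open>\<omega> 0\<close>, a map that preserves the law.\<close>
      have shift: "(\<lambda>\<omega> n. \<omega> (Suc n)) \<in> measurable walk_space (walk_space :: (nat \<Rightarrow> 'a) measure)"
        unfolding walk_space_def by (rule measurable_PiM_single') (auto simp: space_PiM)
      have walk_eq: "ball_walk D \<epsilon> x0 \<omega> = ?Y (\<lambda>n. \<omega> (Suc n))" for \<omega>
        by (rule ext) (simp add: ball_walk_eq_scaled_walk r_def[abs_def])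
      have lim_iff: "(\<exists>y. X \<longlonglongrightarrow> y \<and> y \<in> ball y0 \<delta>) \<longleftrightarrow> Cauchy X \<and> lim X \<in> ball y0 \<delta>" for X :: "nat \<Rightarrow> 'a"
        by (metis LIMSEQ_imp_Cauchy limI Cauchy_convergent convergent_LIMSEQ_iff)
      have "hit_prob D \<epsilon> x0 y0 \<delta> = measure walk_space ((\<lambda>\<omega> n. \<omega> (Suc n)) -` B \<inter> space walk_space)"
        unfolding hit_prob_def walk_eq lim_iff B_def
        by (rule arg_cong[where f = "measure _"]) auto
      also have "\<dots> = measure (distr walk_space walk_space (\<lambda>\<omega> n. \<omega> (Suc n))) B"
        by (rule measure_distr[OF shift B_sets, symmetric])
      also have "\<dots> = measure walk_space B" by (simp only: distr_walk_space_shift)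
      finally show "hit_prob D \<epsilon> x0 y0 \<delta> \<ge> 1 - \<eta>" using B_prob by simp
    qed (use \<delta>' R h in auto)
  qed
qed

end
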